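(* No acute triangle admits a $k$-splitting gentiling for any $k\ge 4$. If an acute triangle $T$ admits a 3-splitting gentiling, then the angles of $T$ are either $(\tfrac{2}{13}\pi,\tfrac{5}{13}\pi,\tfrac{6}{13}\pi)$ or $(\tfrac{2}{15}\pi,\tfrac{6}{15}\pi,\tfrac{7}{15}\pi)$.
   Context: An $r$-gentiling of a triangle $T$ ($r\ge 2$) is a subdivision of $T$ into $r$ triangles (tiles) with pairwise disjoint interiors, each similar to $T$. For $k\ge2$, a $k$-splitting gentiling of $T$ is a gentiling in which exactly $k$ tiles meet at one of the vertices of $T$. A triangle is acute if all its angles are less than $\pi/2$. *)

theory Defs
  imports "HOL-Analysis.Analysis" "HOL-Library.Multiset"
begin

definition is_triangle :: "(real^2) set \<Rightarrow> bool" where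
  "is_triangle T \<longleftrightarrow> (\<exists>a b c. \<not> collinear {a, b, c} \<and> T = convex hull {a, b, c})"

(* The angle at the middle argument b, for a and c different from b. *)
definition angle_at :: "real^2 \<Rightarrow> real^2 \<Rightarrow> real^2 \<Rightarrow> real" where
  "angle_at a b c = arccos (((a - b) \<bullet> (c - b)) / (norm (a - b) * norm (c - b)))"

definition triangle_angles :: "real^2 \<Rightarrow> real^2 \<Rightarrow> real^2 \<Rightarrow> real multiset" where
  "triangle_angles a b c = {# angle_at b a c, angle_at a b c, angle_at a c b #}"

definition acute_triangle :: "real^2 \<Rightarrow> real^2 \<Rightarrow> real^2 \<Rightarrow> bool" where
  "acute_triangle a b c \<longleftrightarrow>
     \<not> collinear {a, b, c} \<and> (\<forall>\<theta> \<in># triangle_angles a b c. \<theta> < pi / 2)"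

(* Orientation-reversing similarities are allowed. *)
definition similar :: "(real^2) set \<Rightarrow> (real^2) set \<Rightarrow> bool" where
  "similar S T \<longleftrightarrow>
     (\<exists>f \<rho>. \<rho> > 0 \<and> (\<forall>x y. dist (f x) (f y) = \<rho> * dist x y) \<and> S = f ` T)"

(* Tiles need not meet edge to edge. *)
definition gentiling :: "nat \<Rightarrow> (real^2) set \<Rightarrow> (real^2) set set \<Rightarrow> bool" where
  "gentiling r T \<T> \<longleftrightarrow>
     r \<ge> 2 \<and> finite \<T> \<and> card \<T> = r \<and> \<Union>\<T> = T \<and>
     (\<forall>S\<in>\<T>. is_triangle S \<and> similar S T) \<and>
     pairwise (\<lambda>S S'. interior S \<inter> interior S' = {}) \<T>"

(* A vertex of the tiled triangle is an extreme point of it, so every tile that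
   contains it has it as one of its own vertices. *)
definition splitting_gentiling ::
    "nat \<Rightarrow> real^2 \<Rightarrow> real^2 \<Rightarrow> real^2 \<Rightarrow> (real^2) set set \<Rightarrow> bool" where
  "splitting_gentiling k a b c \<T> \<longleftrightarrow>
     k \<ge> 2 \<and> (\<exists>r. gentiling r (convex hull {a, b, c}) \<T>) \<and>
     (\<exists>v\<in>{a, b, c}. card {S \<in> \<T>. v \<in> S} = k)"

end

theory Submission imports Defs begin

text \<open>
  At every point \<open>v\<close> of the tiling record the numbers \<open>(l, m, n)\<close> of tiles having \<open>v\<close> as their vertex of
  angle \<open>\<alpha> \<le> \<beta> \<le> \<gamma>\<close>. Summed over all points the three counts agree. Comparing areas in small discs
  around \<open>v\<close> gives \<open>l\<alpha> + m\<beta> + n\<gamma> \<in> {\<pi>, 2\<pi>}\<close> unless \<open>v\<close> is a corner of the big triangle, where the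
  value is the corner angle. Since \<open>\<alpha> + \<beta> > \<pi>/2 > \<gamma>\<close>, a corner angle split into \<open>k \<ge> 3\<close> parts is
  \<open>\<beta> = k\<alpha>\<close> or \<open>\<gamma> = k\<alpha>\<close>, so the corners carry a surplus of \<open>\<alpha>\<close>. The other points would have to
  compensate it, but a linear functional \<open>(p, q, s)\<close> with \<open>p + q + s = 0\<close> is nonnegative at all of them:
  \<open>(2, -1, -1)\<close> if \<open>\<beta> = \<gamma>\<close>; otherwise \<open>(1, 0, -1)\<close> or \<open>(1, -1, 0)\<close> unless the third angle is a
  half-integer multiple of \<open>\<alpha>\<close>, and \<open>(4, -3, -1)\<close> in that case. The last functional fails only for
  \<open>k = 3\<close>, which leaves the proportions \<open>2 : 5 : 6\<close> and \<open>2 : 6 : 7\<close>.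
\<close>

subsection \<open>Areas of circular sectors\<close>

text \<open>Nonnegativity makes \<open>f\<close> monotone, and additivity fixes it on multiples of a
  step \<open>y\<close>. With the step \<open>P / real (Suc N)\<close> this traps \<open>f x\<close>
  within \<open>f P / real (Suc N)\<close> of the linear value. It serves for the area of a sector
  as a function of its angle.\<close>

lemma additive_nonneg_imp_linear:
  fixes f :: "real \<Rightarrow> real"
  assumes add: "\<And>s t. 0 < s \<Longrightarrow> 0 < t \<Longrightarrow> s + t \<le> P \<Longrightarrow> f (s + t) = f s + f t"
    and nonneg: "\<And>s. 0 < s \<Longrightarrow> s \<le> P \<Longrightarrow> 0 \<le> f s"
    and x: "0 < x" "x \<le> P"
  shows "f x = x / P * f P"
proof (cases "x = P")
  case False
  have P: "0 < P" using x by simp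
  have mult: "f (real (Suc j) * y) = real (Suc j) * f y" if "0 < y" "real (Suc j) * y \<le> P" for j y
    using that(2)
  proof (induction j)
    case (Suc j)
    have "f (real (Suc (Suc j)) * y) = f (real (Suc j) * y + y)" by (simp add: algebra_simps)
    also have "\<dots> = f (real (Suc j) * y) + f y"
      using Suc.prems \<open>0 < y\<close> by (intro add) (auto simp: algebra_simps add_pos_nonneg)
    also have "f (real (Suc j) * y) = real (Suc j) * f y"
      using Suc.prems \<open>0 < y\<close> by (intro Suc.IH) (auto simp: algebra_simps)
    finally show ?case by (simp add: algebra_simps)
  qed simp
  have mono: "f s \<le> f t" if "0 < s" "s \<le> t" "t \<le> P" for s t
    using add[of s "t - s"] nonneg[of "t - s"] that by (cases "s = t") auto
  have close: "\<bar>f x - x / P * f P\<bar> \<le> f P / real (Suc N)" for N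
  proof -
    define y where "y = P / real (Suc N)"
    have y: "0 < y" using P by (simp add: y_def)
    have NyP: "real (Suc N) * y = P" by (simp add: y_def)
    have fP: "f P = real (Suc N) * f y" using mult[OF y, of N] NyP by simp
    define j where "j = nat \<lfloor>x / y\<rfloor>"
    have j: "real j \<le> x / y" "x / y < real j + 1"
      using x y unfolding j_def by (auto simp: le_nat_iff)
    have jx: "real j * y \<le> x" "x < real (Suc j) * y"
      using j y by (simp_all add: field_simps)
    have "real j * y < real (Suc N) * y" using jx(1) x False NyP by simp
    then have "j < Suc N" using y by simp
    then have le: "real (Suc j) * y \<le> P"
      unfolding NyP[symmetric] using y by (intro mult_right_mono) auto
    have up: "f x \<le> real (Suc j) * f y"
      using mono[OF x(1) less_imp_le[OF jx(2)] le] mult[OF y le] by simp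
    \<comment> \<open>Additivity covers positive arguments only, so \<open>f 0\<close> is unknown
      and \<open>j = 0\<close> falls back on nonnegativity of \<open>f x\<close>.\<close>
    have lo: "real j * f y \<le> f x"
    proof (cases j)
      case 0
      then show ?thesis using nonneg[OF x] by simp
    next
      case (Suc i)
      have "f (real j * y) = real j * f y"
        using mult[OF y, of i] jx(1) x Suc by simp
      then show ?thesis using mono[of "real j * y" x] jx(1) x y Suc by simp
    qed
    have "1 * y \<le> real (Suc N) * y" using y by (intro mult_right_mono) auto
    then have fy: "0 \<le> f y" using nonneg[OF y] NyP by simp
    have eq: "x / P * f P = x / y * f y" using P y by (simp add: fP y_def field_simps)
    have "real j * f y \<le> x / y * f y" "x / y * f y \<le> (real j + 1) * f y"
      using mult_right_mono[OF j(1) fy] mult_right_mono[OF less_imp_le[OF j(2)] fy] by simp_all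
    then have "\<bar>f x - x / P * f P\<bar> \<le> f y" using up lo unfolding eq by (simp add: algebra_simps abs_le_iff)
    also have "f y = f P / real (Suc N)" unfolding fP by simp
    finally show ?thesis .
  qed
  have "(\<lambda>N. f P / real (Suc N)) \<longlonglongrightarrow> 0"
    using LIMSEQ_Suc[OF lim_const_over_n] by simp
  then have "\<bar>f x - x / P * f P\<bar> \<le> 0"
    by (rule LIMSEQ_le_const) (use close in blast)
  then show ?thesis by simp
qed (use x in auto)

definition det2 :: "real^2 \<Rightarrow> real^2 \<Rightarrow> real" where
  "det2 u w = u $ 1 * w $ 2 - u $ 2 * w $ 1"

lemma inner_real2: "u \<bullet> w = u $ 1 * w $ 1 + u $ 2 * w $ 2" for u w :: "real^2"
  by (simp add: inner_vec_def sum_2)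

text \<open>Lagrange's identity: it turns \<open>det2\<close> into a sine wherever the inner product
  gives the cosine.\<close>

lemma det2_squared: "(u \<bullet> w)\<^sup>2 + (det2 u w)\<^sup>2 = (norm u)\<^sup>2 * (norm w)\<^sup>2"
  unfolding power2_norm_eq_inner inner_real2 det2_def by (simp add: power2_eq_square algebra_simps)

text \<open>For a unit vector \<open>u\<close> and a sign \<open>s\<close>, the coordinates of
  \<open>x\<close> in the orthonormal basis of \<open>u\<close> and \<open>u\<close> turned by a
  right angle, to the left or to the right. The sign lets cones of both orientations be moved to one
  standard position.\<close>

definition frame :: "real \<Rightarrow> real^2 \<Rightarrow> real^2 \<Rightarrow> real^2" where
  "frame s u x = vector [u \<bullet> x, s * det2 u x]"

lemma frame_nth [simp]: "frame s u x $ 1 = u \<bullet> x" "frame s u x $ 2 = s * det2 u x"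
  by (simp_all add: frame_def)

lemma orthogonal_frame:
  assumes "norm u = 1" "s\<^sup>2 = 1"
  shows "orthogonal_transformation (frame s u)"
  unfolding orthogonal_transformation
proof (intro conjI allI)
  show "linear (frame s u)"
    by (rule linearI) (simp_all add: vec_eq_iff forall_2 det2_def inner_real2 algebra_simps)
  fix x
  have "(norm (frame s u x))\<^sup>2 = (norm x)\<^sup>2"
    using det2_squared[of u x] assms
    by (simp add: power2_norm_eq_inner[of "frame s u x"] inner_real2[of "frame s u x"]
        power2_eq_square[symmetric] power_mult_distrib)
  then show "norm (frame s u x) = norm x" by simp
qed

lemma measure_ball_orthogonal_vimage:
  fixes f :: "real^2 \<Rightarrow> real^2"
  assumes f: "orthogonal_transformation f" and S: "ball 0 e \<inter> S \<in> lmeasurable"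
  shows "measure lebesgue (ball 0 e \<inter> f -` S) = measure lebesgue (ball 0 e \<inter> S)"
proof -
  have "bij f" by (rule orthogonal_transformation_bij[OF f])
  moreover have "norm (f x) = norm x" for x using f by (rule orthogonal_transformation_norm)
  ultimately have "ball 0 e \<inter> f -` S = inv f ` (ball 0 e \<inter> S)"
    by (auto simp: bij_image_Collect_eq image_iff bij_inv_eq_iff) (metis bij_inv_eq_iff)+
  then show ?thesis
    using measure_orthogonal_image[OF orthogonal_transformation_inv[OF f] S] by simp
qed

lemma lmeasurable_ball_Int_closed: "closed S \<Longrightarrow> ball a e \<inter> S \<in> lmeasurable"
  for S :: "(real^2) set"
  by (intro bounded_set_imp_lmeasurable) (auto simp: bounded_Int)

text \<open>The half-plane and its reflection in the origin cut equal areas from the disc, cover it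
  together and share only a line.\<close>

lemma measure_ball_halfplane:
  fixes n :: "real^2"
  assumes n: "n \<noteq> 0" and e: "0 \<le> e"
  shows "measure lebesgue (ball 0 e \<inter> {x. 0 \<le> n \<bullet> x}) = pi / 2 * e\<^sup>2"
proof -
  define H where "H = {x. 0 \<le> n \<bullet> x}"
  define H' where "H' = uminus -` H"
  have cl: "closed H" "closed H'"
    unfolding H_def H'_def vimage_def by (auto intro!: closed_Collect_le continuous_intros)
  note meas = cl[THEN lmeasurable_ball_Int_closed, of 0 e]
  have "orthogonal_transformation (uminus :: real^2 \<Rightarrow> real^2)"
    by (simp add: orthogonal_transformation_def linear_uminus)
  then have eq: "measure lebesgue (ball 0 e \<inter> H') = measure lebesgue (ball 0 e \<inter> H)"
    unfolding H'_def using meas(1) by (rule measure_ball_orthogonal_vimage)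
  have "(ball 0 e \<inter> H) \<inter> (ball 0 e \<inter> H') \<subseteq> {x. n \<bullet> x = 0}"
    by (auto simp: H_def H'_def)
  then have "negligible ((ball 0 e \<inter> H) \<inter> (ball 0 e \<inter> H'))"
    using negligible_hyperplane[of n 0] n by (blast intro: negligible_subset)
  then have "measure lebesgue ((ball 0 e \<inter> H) \<inter> (ball 0 e \<inter> H')) = 0"
    by (rule negligible_imp_measure0)
  then have "measure lebesgue ((ball 0 e \<inter> H) \<union> (ball 0 e \<inter> H'))
      = measure lebesgue (ball 0 e \<inter> H) + measure lebesgue (ball 0 e \<inter> H')"
    using measure_Un3[OF meas] by simp
  also have "(ball 0 e \<inter> H) \<union> (ball 0 e \<inter> H') = ball 0 e"
    by (auto simp: H_def H'_def)
  also have "measure lebesgue (ball (0 :: real^2) e) = e\<^sup>2 * pi"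
    using circle_area[OF e] by (simp add: measure_completion)
  finally show ?thesis unfolding eq H_def by (simp add: mult.commute)
qed

text \<open>For 0 < \<theta> \<le> pi these are the points with polar angle from 0 to \<theta>: at
  radius rho and polar angle phi the second inequality reads rho * sin (phi - \<theta>) \<le>
  0.\<close>

definition sector :: "real \<Rightarrow> (real^2) set" where
  "sector \<theta> = {x. 0 \<le> x $ 2 \<and> x $ 2 * cos \<theta> \<le> x $ 1 * sin \<theta>}"

lemma closed_sector: "closed (sector \<theta>)"
  unfolding sector_def by (auto intro!: closed_Collect_conj closed_Collect_le continuous_intros)

lemma sector_add:
  assumes s: "0 < s" and t: "0 < t" and st: "s + t \<le> pi"
  shows "sector (s + t) = sector s \<union> frame 1 (vector [cos s, sin s]) -` sector t"
proof -
  have sin_pos: "0 < sin s" "0 < sin t" using s t st by (auto intro!: sin_gt_zero)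
  have sin_st: "0 \<le> sin (s + t)" using s t st by (auto intro!: sin_ge_zero)
  have "x \<in> sector (s + t) \<longleftrightarrow> x \<in> sector s \<or> frame 1 (vector [cos s, sin s]) x \<in> sector t" for x
  proof -
    define y1 y2 where "y1 = x $ 1 * cos s + x $ 2 * sin s" and "y2 = cos s * x $ 2 - sin s * x $ 1"
    have fr: "frame 1 (vector [cos s, sin s]) x \<in> sector t \<longleftrightarrow> 0 \<le> y2 \<and> y2 * cos t \<le> y1 * sin t"
      by (simp add: sector_def inner_real2 det2_def y1_def y2_def algebra_simps)
    have id1: "y1 * sin t - y2 * cos t = x $ 1 * sin (s + t) - x $ 2 * cos (s + t)"
      by (simp add: y1_def y2_def sin_add cos_add algebra_simps)
    have x2: "x $ 2 = y1 * sin s + y2 * cos s"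
    proof -
      have "y1 * sin s + y2 * cos s = x $ 2 * ((sin s)\<^sup>2 + (cos s)\<^sup>2)"
        unfolding y1_def y2_def by algebra
      then show ?thesis by simp
    qed
    \<comment> \<open>\<open>id2\<close> and \<open>id3\<close> are one relation among sines, solved
      for two different terms. On the rotated sector it makes \<open>x $ 2\<close> nonnegative; on
      \<open>sector s\<close> it yields the second inequality of
      \<open>sector (s + t)\<close>.\<close>
    have id2: "sin t * x $ 2 = sin s * (y1 * sin t - y2 * cos t) + y2 * sin (s + t)"
      by (simp add: x2 sin_add algebra_simps)
    have sint: "sin t = sin (s + t) * cos s - cos (s + t) * sin s"
      using sin_diff[of "s + t" s] by simp
    have id3: "sin s * (x $ 1 * sin (s + t) - x $ 2 * cos (s + t)) = - sin (s + t) * y2 + x $ 2 * sin t"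
      unfolding sint by (simp add: y2_def algebra_simps)
    show ?thesis
    proof
      assume "x \<in> sector (s + t)"
      then show "x \<in> sector s \<or> frame 1 (vector [cos s, sin s]) x \<in> sector t"
        unfolding fr using id1 by (auto simp: sector_def y2_def algebra_simps)
    next
      assume "x \<in> sector s \<or> frame 1 (vector [cos s, sin s]) x \<in> sector t"
      then show "x \<in> sector (s + t)"
      proof
        assume "x \<in> sector s"
        then have x: "0 \<le> x $ 2" "y2 \<le> 0" by (auto simp: sector_def y2_def algebra_simps)
        then have "0 \<le> sin s * (x $ 1 * sin (s + t) - x $ 2 * cos (s + t))"
          unfolding id3 using mult_nonneg_nonpos[OF sin_st x(2)] mult_nonneg_nonneg[OF x(1), of "sin t"] sin_pos
          by linarith
        then show ?thesis using x sin_pos by (simp add: sector_def zero_le_mult_iff)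
      next
        assume "frame 1 (vector [cos s, sin s]) x \<in> sector t"
        then have y: "0 \<le> y2" "0 \<le> y1 * sin t - y2 * cos t" unfolding fr by auto
        then have "0 \<le> sin t * x $ 2" unfolding id2 using sin_st sin_pos by simp
        then have "0 \<le> x $ 2" using sin_pos by (simp add: zero_le_mult_iff)
        then show ?thesis using y(2) unfolding id1 by (simp add: sector_def)
      qed
    qed
  qed
  then show ?thesis by blast
qed

lemma measure_ball_sector_add:
  assumes s: "0 < s" and t: "0 < t" and st: "s + t \<le> pi"
  shows "measure lebesgue (ball 0 e \<inter> sector (s + t))
    = measure lebesgue (ball 0 e \<inter> sector s) + measure lebesgue (ball 0 e \<inter> sector t)"
proof -
  define u :: "real^2" where "u = vector [cos s, sin s]"
  define T where "T = frame 1 u -` sector t"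
  have "norm u = 1" by (simp add: u_def norm_eq_sqrt_inner inner_real2 flip: power2_eq_square)
  then have orth: "orthogonal_transformation (frame 1 u)" by (rule orthogonal_frame) simp
  have "closed T" unfolding T_def
    by (intro closed_vimage closed_sector linear_continuous_on
        linear_conv_bounded_linear[THEN iffD1] orthogonal_transformation_linear[OF orth])
  note meas = lmeasurable_ball_Int_closed[OF closed_sector, of 0 e s] lmeasurable_ball_Int_closed[OF this, of 0 e]
  \<comment> \<open>\<open>n\<close> is normal to the ray shared by the two sectors.\<close>
  define n :: "real^2" where "n = vector [- sin s, cos s]"
  have "n \<noteq> 0"
  proof
    assume "n = 0"
    then have "n $ 1 = 0" "n $ 2 = 0" by simp_all
    then show False using sin_cos_squared_add[of s] by (simp add: n_def)
  qed
  have "(ball 0 e \<inter> sector s) \<inter> (ball 0 e \<inter> T) \<subseteq> {x. n \<bullet> x = 0}"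
    by (auto simp: sector_def T_def n_def u_def inner_real2 det2_def algebra_simps)
  then have "negligible ((ball 0 e \<inter> sector s) \<inter> (ball 0 e \<inter> T))"
    using negligible_hyperplane[of n 0] \<open>n \<noteq> 0\<close> by (blast intro: negligible_subset)
  then have "measure lebesgue ((ball 0 e \<inter> sector s) \<inter> (ball 0 e \<inter> T)) = 0"
    by (rule negligible_imp_measure0)
  then have "measure lebesgue ((ball 0 e \<inter> sector s) \<union> (ball 0 e \<inter> T))
      = measure lebesgue (ball 0 e \<inter> sector s) + measure lebesgue (ball 0 e \<inter> T)"
    using measure_Un3[OF meas] by simp
  also have "(ball 0 e \<inter> sector s) \<union> (ball 0 e \<inter> T) = ball 0 e \<inter> sector (s + t)"
    using sector_add[OF assms] by (auto simp: T_def u_def)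
  also have "measure lebesgue (ball 0 e \<inter> T) = measure lebesgue (ball 0 e \<inter> sector t)"
    unfolding T_def by (intro measure_ball_orthogonal_vimage orth lmeasurable_ball_Int_closed closed_sector)
  finally show ?thesis .
qed

text \<open>Additivity makes the area proportional to the angle; the half-plane at \<open>pi\<close>
  fixes the factor.\<close>

lemma measure_ball_sector:
  assumes \<theta>: "0 < \<theta>" "\<theta> \<le> pi" and e: "0 \<le> e"
  shows "measure lebesgue (ball 0 e \<inter> sector \<theta>) = \<theta> / 2 * e\<^sup>2"
proof -
  have "measure lebesgue (ball 0 e \<inter> sector \<theta>) = \<theta> / pi * measure lebesgue (ball 0 e \<inter> sector pi)"
    using \<theta> by (intro additive_nonneg_imp_linear measure_ball_sector_add) auto
  also have "sector pi = {x. 0 \<le> axis 2 1 \<bullet> x}" by (simp add: sector_def inner_axis')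
  also have "measure lebesgue (ball 0 e \<inter> \<dots>) = pi / 2 * e\<^sup>2"
    using e by (intro measure_ball_halfplane) (auto simp: axis_eq_0_iff)
  finally show ?thesis by simp
qed

text \<open>As \<open>det2 u w\<close> is nonzero, Lagrange's identity puts the cosine strictly
  between -1 and 1 and gives the sine up to its sign, which is positive.\<close>

lemma arccos_inner:
  assumes uw: "det2 u w \<noteq> 0"
  defines "\<theta> \<equiv> arccos (u \<bullet> w / (norm u * norm w))"
  shows "0 < \<theta>" "\<theta> < pi" "cos \<theta> = u \<bullet> w / (norm u * norm w)"
    "sin \<theta> = \<bar>det2 u w\<bar> / (norm u * norm w)"
proof -
  define c where "c = u \<bullet> w / (norm u * norm w)"
  have "u \<noteq> 0" "w \<noteq> 0" using uw by (auto simp: det2_def)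
  then have pos: "0 < norm u" "0 < norm w" by auto
  have cs: "c\<^sup>2 + (det2 u w / (norm u * norm w))\<^sup>2 = 1"
    using det2_squared[of u w] pos
    by (simp add: c_def power_divide power_mult_distrib flip: add_divide_distrib)
  have "0 < (det2 u w / (norm u * norm w))\<^sup>2" using uw pos by simp
  then have "c\<^sup>2 < 1" using cs by linarith
  then have c1: "\<bar>c\<bar> < 1" by (simp add: abs_square_less_1)
  have \<theta>_c: "\<theta> = arccos c" by (simp add: \<theta>_def c_def)
  show "0 < \<theta>" "\<theta> < pi" using c1 arccos_lt_bounded[of c] by (auto simp: \<theta>_c)
  show "cos \<theta> = u \<bullet> w / (norm u * norm w)" using c1 by (simp add: \<theta>_c flip: c_def)
  have "sin \<theta> = sqrt (1 - c\<^sup>2)" unfolding \<theta>_c using c1 by (intro sin_arccos) auto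
  also have "1 - c\<^sup>2 = (det2 u w / (norm u * norm w))\<^sup>2" using cs by simp
  finally show "sin \<theta> = \<bar>det2 u w\<bar> / (norm u * norm w)" by simp
qed

text \<open>By Cramer's rule the two quotients are the coordinates of \<open>x\<close> in the basis
  \<open>u\<close>, \<open>w\<close>, so the set is the cone spanned by \<open>u\<close> and
  \<open>w\<close>. The frame along \<open>u\<close>, oriented by the sign of
  \<open>det2 u w\<close>, carries it to a standard sector.\<close>

lemma measure_ball_cone:
  assumes uw: "det2 u w \<noteq> 0" and e: "0 \<le> e"
  shows "measure lebesgue (ball 0 e \<inter> {x. 0 \<le> det2 x w / det2 u w \<and> 0 \<le> det2 u x / det2 u w})
    = arccos (u \<bullet> w / (norm u * norm w)) / 2 * e\<^sup>2"
proof -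
  define c \<theta> where "c = u \<bullet> w / (norm u * norm w)" and "\<theta> = arccos c"
  have nz: "u \<noteq> 0" "w \<noteq> 0" using uw by (auto simp: det2_def)
  then have pos: "0 < norm u" "0 < norm w" by auto
  note \<theta> = arccos_inner(1,2)[OF uw, folded c_def, folded \<theta>_def]
  note cos\<theta> = arccos_inner(3)[OF uw, folded c_def, folded \<theta>_def]
  note sin\<theta> = arccos_inner(4)[OF uw, folded c_def, folded \<theta>_def]
  define s where "s = sgn (det2 u w)"
  define v where "v = (1 / norm u) *\<^sub>R u"
  have s: "s\<^sup>2 = 1" using uw by (simp add: s_def sgn_if)
  have "norm v = 1" using nz by (simp add: v_def)
  then have orth: "orthogonal_transformation (frame s v)" using s by (rule orthogonal_frame)
  have "x \<in> frame s v -` sector \<theta> \<longleftrightarrow> 0 \<le> det2 x w / det2 u w \<and> 0 \<le> det2 u x / det2 u w" for x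
  proof -
    have 1: "0 \<le> frame s v x $ 2 \<longleftrightarrow> 0 \<le> det2 u x / det2 u w"
    proof -
      have "frame s v x $ 2 = s * det2 u x / norm u"
        by (simp add: v_def det2_def diff_divide_distrib right_diff_distrib mult_ac)
      then show ?thesis using pos uw by (auto simp: s_def sgn_if zero_le_divide_iff)
    qed
    have id: "(u \<bullet> x) * det2 u w - det2 u x * (u \<bullet> w) = (norm u)\<^sup>2 * det2 x w"
      unfolding power2_norm_eq_inner inner_real2 det2_def by (simp add: algebra_simps)
    have "frame s v x $ 1 * sin \<theta> - frame s v x $ 2 * cos \<theta>
        = s * ((u \<bullet> x) * det2 u w - det2 u x * (u \<bullet> w)) / ((norm u)\<^sup>2 * norm w)"
      using pos by (simp add: v_def det2_def cos\<theta> sin\<theta> c_def s_def power2_eq_square abs_sgn field_simps)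
    also have "\<dots> = s * det2 x w / norm w" unfolding id using pos by simp
    finally have "frame s v x $ 2 * cos \<theta> \<le> frame s v x $ 1 * sin \<theta> \<longleftrightarrow> 0 \<le> s * det2 x w / norm w"
      by (metis diff_ge_0_iff_ge)
    also have "\<dots> \<longleftrightarrow> 0 \<le> det2 x w / det2 u w"
      using pos uw by (auto simp: s_def sgn_if zero_le_divide_iff)
    finally show ?thesis using 1 by (auto simp: sector_def)
  qed
  then have "{x. 0 \<le> det2 x w / det2 u w \<and> 0 \<le> det2 u x / det2 u w} = frame s v -` sector \<theta>" by blast
  then show ?thesis
    using measure_ball_orthogonal_vimage[OF orth lmeasurable_ball_Int_closed[OF closed_sector]]
      measure_ball_sector[of \<theta> e] \<theta> e by (simp add: \<theta>_def c_def)
qed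

subsection \<open>Local angles of triangles\<close>

text \<open>Area in small discs gives one notion of angle for vertices, edge points, interior and
  exterior points alike. Additivity of measure then adds the angles of the tiles without any cyclic
  order around \<open>v\<close>.\<close>

definition has_angle :: "(real^2) set \<Rightarrow> real^2 \<Rightarrow> real \<Rightarrow> bool" where
  "has_angle S v \<theta> \<longleftrightarrow> (\<forall>\<^sub>F e in at_right 0. measure lebesgue (ball v e \<inter> S) = \<theta> / 2 * e\<^sup>2)"

lemma has_angle_unique:
  assumes "has_angle S v \<theta>" "has_angle S v \<theta>'"
  shows "\<theta> = \<theta>'"
proof -
  have "\<forall>\<^sub>F e::real in at_right 0. 0 < e" by (rule eventually_at_right_less)
  with assms have "\<forall>\<^sub>F e::real in at_right 0. \<theta> = \<theta>'"
    unfolding has_angle_def by eventually_elim simp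
  then show ?thesis by simp
qed

text \<open>Near \<open>v\<close> the set is a translate of \<open>K\<close>, so small discs meet
  both in equal area. For triangles \<open>K\<close> is a cone, a half-plane, the plane or
  empty.\<close>

lemma has_angleI:
  assumes "\<forall>\<^sub>F y in nhds v. y \<in> S \<longleftrightarrow> y - v \<in> K"
    and "\<And>e. 0 < e \<Longrightarrow> measure lebesgue (ball 0 e \<inter> K) = \<theta> / 2 * e\<^sup>2"
  shows "has_angle S v \<theta>"
proof -
  obtain d where d: "0 < d" "\<And>y. dist y v < d \<Longrightarrow> y \<in> S \<longleftrightarrow> y - v \<in> K"
    using assms(1) unfolding eventually_nhds_metric by blast
  have "measure lebesgue (ball v e \<inter> S) = \<theta> / 2 * e\<^sup>2" if "0 < e" "e < d" for e
  proof -
    have "ball v e \<inter> S = (+) v ` (ball 0 e \<inter> K)"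
    proof (intro set_eqI iffI)
      fix y assume "y \<in> ball v e \<inter> S"
      then have "y - v \<in> ball 0 e \<inter> K" "y = v + (y - v)"
        using d(2)[of y] that by (auto simp: dist_norm norm_minus_commute)
      then show "y \<in> (+) v ` (ball 0 e \<inter> K)" by (rule rev_image_eqI)
    next
      fix y assume "y \<in> (+) v ` (ball 0 e \<inter> K)"
      then show "y \<in> ball v e \<inter> S" using d(2)[of y] that by (auto simp: dist_norm)
    qed
    then show ?thesis using assms(2)[OF that(1)] by (simp add: measure_translation)
  qed
  then show ?thesis
    unfolding has_angle_def eventually_at_right_field using d(1) by blast
qed

lemma has_angle_outside:
  assumes "closed S" "v \<notin> S"
  shows "has_angle S v 0"
proof (rule has_angleI[where K = "{}"])
  have "\<forall>\<^sub>F y in nhds v. y \<in> - S"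
    using assms by (intro eventually_nhds_in_open) auto
  then show "\<forall>\<^sub>F y in nhds v. y \<in> S \<longleftrightarrow> y - v \<in> {}" by eventually_elim simp
qed simp

text \<open>Closed convex sets with disjoint interiors overlap only in their frontiers, which are
  null sets, so the areas add up in every small disc.\<close>

lemma has_angle_Union:
  assumes fin: "finite \<T>" and S: "\<And>S. S \<in> \<T> \<Longrightarrow> convex S \<and> closed S"
    and disj: "pairwise (\<lambda>S S'. interior S \<inter> interior S' = {}) \<T>"
    and ang: "\<And>S. S \<in> \<T> \<Longrightarrow> has_angle S v (\<theta> S)"
  shows "has_angle (\<Union>\<T>) v (\<Sum>S\<in>\<T>. \<theta> S)"
proof -
  have "\<forall>\<^sub>F e in at_right 0. \<forall>S\<in>\<T>. measure lebesgue (ball v e \<inter> S) = \<theta> S / 2 * e\<^sup>2"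
    using ang fin by (intro eventually_ball_finite) (auto simp: has_angle_def)
  then show ?thesis unfolding has_angle_def
  proof eventually_elim
    case (elim e)
    have "negligible (ball v e \<inter> S \<inter> (ball v e \<inter> S'))" if "S \<in> \<T>" "S' \<in> \<T>" "S \<noteq> S'" for S S'
    proof -
      have "S \<inter> S' \<subseteq> frontier S \<union> frontier S'"
        using S that disj by (auto simp: frontier_def pairwise_def)
      moreover have "negligible (frontier S \<union> frontier S')"
        using S that by (intro negligible_Un negligible_convex_frontier) auto
      ultimately show ?thesis by (blast intro: negligible_subset)
    qed
    then have "measure lebesgue (\<Union>S\<in>\<T>. ball v e \<inter> S) = (\<Sum>S\<in>\<T>. measure lebesgue (ball v e \<inter> S))"
      using fin S by (intro measure_negligible_finite_Union_image lmeasurable_ball_Int_closed)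
        (auto simp: pairwise_def)
    then show ?case using elim by (simp add: sum_distrib_right sum_divide_distrib flip: UN_extend_simps)
  qed
qed

section \<open>Barycentric coordinates and the local shape of a triangle\<close>

lemma collinear_if_det2_eq_0:
  assumes "det2 (b - a) (c - a) = 0"
  shows "collinear {a, b, c}"
proof -
  define u w where "u = b - a" and "w = c - a"
  have d: "u $ 1 * w $ 2 = u $ 2 * w $ 1" using assms by (simp add: det2_def u_def w_def)
  have "collinear {0, u, w}"
  proof (cases "u = 0")
    case False
    have "w = (u \<bullet> w / (u \<bullet> u)) *\<^sub>R u"
    proof -
      have "(u \<bullet> u) *\<^sub>R w = (u \<bullet> w) *\<^sub>R u"
        using d by (simp add: vec_eq_iff forall_2 inner_real2) algebra
      then have "(1 / (u \<bullet> u)) *\<^sub>R ((u \<bullet> u) *\<^sub>R w) = (1 / (u \<bullet> u)) *\<^sub>R ((u \<bullet> w) *\<^sub>R u)" by simp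
      then show ?thesis using False by simp
    qed
    then show ?thesis unfolding collinear_lemma by blast
  qed (simp add: collinear_lemma)
  then have "collinear {b, a, c}"
    by (simp add: collinear_3[of b a c] u_def w_def)
  then show ?thesis by (simp add: insert_commute)
qed

text \<open>The barycentric coordinate of \<open>x\<close> belonging to \<open>a\<close>, as a
  quotient of signed areas, so that the orientation cancels. Rotating the arguments cyclically gives
  the coordinates for \<open>b\<close> and \<open>c\<close>.\<close>

definition bary :: "real^2 \<Rightarrow> real^2 \<Rightarrow> real^2 \<Rightarrow> real^2 \<Rightarrow> real" where
  "bary a b c x = det2 (b - x) (c - x) / det2 (b - a) (c - a)"

lemma det2_rotate: "det2 (c - b) (a - b) = det2 (b - a) (c - a)"
  "det2 (a - c) (b - c) = det2 (b - a) (c - a)"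
  by (simp_all add: det2_def algebra_simps)

lemma bary_sum:
  assumes "det2 (b - a) (c - a) \<noteq> 0"
  shows "bary a b c x + bary b c a x + bary c a b x = 1"
proof -
  have "det2 (b - x) (c - x) + det2 (c - x) (a - x) + det2 (a - x) (b - x) = det2 (b - a) (c - a)"
    by (simp add: det2_def algebra_simps)
  then show ?thesis using assms by (simp add: bary_def det2_rotate flip: add_divide_distrib)
qed

lemma bary_combination:
  assumes "det2 (b - a) (c - a) \<noteq> 0"
  shows "x = bary a b c x *\<^sub>R a + bary b c a x *\<^sub>R b + bary c a b x *\<^sub>R c"
proof -
  have "det2 (b - a) (c - a) *\<^sub>R x = det2 (b - x) (c - x) *\<^sub>R a + det2 (c - x) (a - x) *\<^sub>R b
      + det2 (a - x) (b - x) *\<^sub>R c"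
    by (simp add: vec_eq_iff forall_2 det2_def algebra_simps)
  then have "(1 / det2 (b - a) (c - a)) *\<^sub>R det2 (b - a) (c - a) *\<^sub>R x
      = (1 / det2 (b - a) (c - a)) *\<^sub>R (det2 (b - x) (c - x) *\<^sub>R a + det2 (c - x) (a - x) *\<^sub>R b
      + det2 (a - x) (b - x) *\<^sub>R c)" by simp
  then show ?thesis using assms by (simp add: bary_def det2_rotate scaleR_add_right)
qed

lemma bary_of_combination:
  assumes "det2 (b - a) (c - a) \<noteq> 0" "u + v + w = 1"
  shows "bary a b c (u *\<^sub>R a + v *\<^sub>R b + w *\<^sub>R c) = u"
proof -
  have u: "u = 1 - v - w" using assms(2) by simp
  have "det2 (b - (u *\<^sub>R a + v *\<^sub>R b + w *\<^sub>R c)) (c - (u *\<^sub>R a + v *\<^sub>R b + w *\<^sub>R c)) = u * det2 (b - a) (c - a)"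
    unfolding u by (simp add: det2_def algebra_simps)
  then show ?thesis using assms(1) by (simp add: bary_def)
qed

lemma mem_triangle_iff:
  assumes D: "det2 (b - a) (c - a) \<noteq> 0"
  shows "x \<in> convex hull {a, b, c} \<longleftrightarrow> 0 \<le> bary a b c x \<and> 0 \<le> bary b c a x \<and> 0 \<le> bary c a b x"
proof
  assume "x \<in> convex hull {a, b, c}"
  then obtain u v w where x: "x = u *\<^sub>R a + v *\<^sub>R b + w *\<^sub>R c" "0 \<le> u" "0 \<le> v" "0 \<le> w" "u + v + w = 1"
    unfolding convex_hull_3 by blast
  have "bary a b c x = u" using bary_of_combination[OF D x(5)] x(1) by simp
  moreover have "bary b c a x = v"
    using bary_of_combination[of c b a v w u] D x(1,5) by (simp add: det2_rotate add_ac)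
  moreover have "bary c a b x = w"
    using bary_of_combination[of a c b w u v] D x(1,5) by (simp add: det2_rotate add_ac)
  ultimately show "0 \<le> bary a b c x \<and> 0 \<le> bary b c a x \<and> 0 \<le> bary c a b x" using x by simp
next
  assume "0 \<le> bary a b c x \<and> 0 \<le> bary b c a x \<and> 0 \<le> bary c a b x"
  then show "x \<in> convex hull {a, b, c}"
    unfolding convex_hull_3 using bary_combination[OF D, of x] bary_sum[OF D, of x] by blast
qed

lemma bary_offset: "bary a b c y = bary a b c v + det2 (y - v) (b - c) / det2 (b - a) (c - a)"
proof -
  have "det2 (b - y) (c - y) = det2 (b - v) (c - v) + det2 (y - v) (b - c)"
    by (simp add: det2_def algebra_simps)
  then show ?thesis by (simp add: bary_def add_divide_distrib)
qed

text \<open>Because of this, only the coordinates vanishing at \<open>v\<close> restrict the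
  triangle near \<open>v\<close>: two at a vertex, one inside an edge, none in the interior.\<close>

lemma eventually_bary_pos:
  assumes "0 < bary a b c v"
  shows "\<forall>\<^sub>F y in nhds v. 0 < bary a b c y"
proof -
  have "open {y. 0 < bary a b c y}"
    unfolding bary_def det2_def divide_inverse by (intro open_Collect_less continuous_intros)
  then show ?thesis using eventually_nhds_in_open[of "{y. 0 < bary a b c y}" v] assms by simp
qed

lemma has_angle_vertex:
  assumes D: "det2 (b - a) (c - a) \<noteq> 0"
  shows "has_angle (convex hull {a, b, c}) a (angle_at b a c)"
proof (rule has_angleI[where K = "{x. 0 \<le> det2 x (c - a) / det2 (b - a) (c - a) \<and>
    0 \<le> det2 (b - a) x / det2 (b - a) (c - a)}"])
  have "bary a b c a = 1" using D by (simp add: bary_def)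
  then have "\<forall>\<^sub>F y in nhds a. 0 < bary a b c y" by (intro eventually_bary_pos) simp
  then show "\<forall>\<^sub>F y in nhds a. y \<in> convex hull {a, b, c} \<longleftrightarrow>
    y - a \<in> {x. 0 \<le> det2 x (c - a) / det2 (b - a) (c - a) \<and> 0 \<le> det2 (b - a) x / det2 (b - a) (c - a)}"
  proof eventually_elim
    case (elim y)
    have "bary b c a a = 0" "bary c a b a = 0" by (simp_all add: bary_def det2_def)
    moreover have "det2 (y - a) (a - b) = det2 (b - a) (y - a)" by (simp add: det2_def algebra_simps)
    ultimately show ?case
      using elim bary_offset[of b c a y a] bary_offset[of c a b y a]
      unfolding mem_triangle_iff[OF D] by (simp add: det2_rotate)
  qed
qed (use measure_ball_cone[OF D] in \<open>simp add: angle_at_def\<close>)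

text \<open>The explicit vector is an inner normal of the edge from \<open>b\<close> to
  \<open>c\<close>, scaled so that its inner product with \<open>y - v\<close> is the increment of
  the vanishing coordinate.\<close>

lemma has_angle_edge:
  assumes D: "det2 (b - a) (c - a) \<noteq> 0"
    and v: "bary a b c v = 0" "0 < bary b c a v" "0 < bary c a b v"
  shows "has_angle (convex hull {a, b, c}) v pi"
proof (rule has_angleI[where K = "{x. 0 \<le> vector [(b - c) $ 2 / det2 (b - a) (c - a),
    (c - b) $ 1 / det2 (b - a) (c - a)] \<bullet> x}"])
  show "\<forall>\<^sub>F y in nhds v. y \<in> convex hull {a, b, c} \<longleftrightarrow>
    y - v \<in> {x. 0 \<le> vector [(b - c) $ 2 / det2 (b - a) (c - a), (c - b) $ 1 / det2 (b - a) (c - a)] \<bullet> x}"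
    using eventually_bary_pos[OF v(2)] eventually_bary_pos[OF v(3)]
  proof eventually_elim
    case (elim y)
    have "vector [(b - c) $ 2 / det2 (b - a) (c - a), (c - b) $ 1 / det2 (b - a) (c - a)] \<bullet> (y - v)
        = det2 (y - v) (b - c) / det2 (b - a) (c - a)"
      by (simp add: inner_real2 det2_def[of "y - v"] algebra_simps diff_divide_distrib add_divide_distrib)
    then show ?case
      using elim bary_offset[of a b c y v] v(1) unfolding mem_triangle_iff[OF D] by simp
  qed
  have "(vector [(b - c) $ 2 / det2 (b - a) (c - a), (c - b) $ 1 / det2 (b - a) (c - a)] :: real^2) \<noteq> 0"
    using D by (auto simp: vec_eq_iff forall_2 det2_def)
  then show "measure lebesgue (ball (0 :: real^2) e \<inter> {x. 0 \<le> vector [(b - c) $ 2 / det2 (b - a) (c - a),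
      (c - b) $ 1 / det2 (b - a) (c - a)] \<bullet> x}) = pi / 2 * e\<^sup>2" if "0 < e" for e
    using that by (intro measure_ball_halfplane) auto
qed

lemma has_angle_inside:
  assumes D: "det2 (b - a) (c - a) \<noteq> 0"
    and v: "0 < bary a b c v" "0 < bary b c a v" "0 < bary c a b v"
  shows "has_angle (convex hull {a, b, c}) v (2 * pi)"
proof (rule has_angleI[where K = UNIV])
  show "\<forall>\<^sub>F y in nhds v. y \<in> convex hull {a, b, c} \<longleftrightarrow> y - v \<in> UNIV"
    using v[THEN eventually_bary_pos] by eventually_elim (simp add: mem_triangle_iff[OF D])
  show "measure lebesgue (ball 0 e \<inter> UNIV :: (real^2) set) = 2 * pi / 2 * e\<^sup>2" if "0 < e" for e
    using circle_area[of e 0] that by (simp add: measure_completion mult.commute)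
qed

lemma has_angle_nonvertex:
  assumes D: "det2 (b - a) (c - a) \<noteq> 0" and v: "v \<in> convex hull {a, b, c}" "v \<notin> {a, b, c}"
  shows "has_angle (convex hull {a, b, c}) v pi \<or> has_angle (convex hull {a, b, c}) v (2 * pi)"
proof -
  define p q r where "p = bary a b c v" and "q = bary b c a v" and "r = bary c a b v"
  have nn: "0 \<le> p" "0 \<le> q" "0 \<le> r"
    using v(1) unfolding mem_triangle_iff[OF D] by (auto simp: p_def q_def r_def)
  have sum: "p + q + r = 1" unfolding p_def q_def r_def by (rule bary_sum[OF D])
  have comb: "v = p *\<^sub>R a + q *\<^sub>R b + r *\<^sub>R c" unfolding p_def q_def r_def by (rule bary_combination[OF D])
  \<comment> \<open>Two vanishing coordinates would make \<open>v\<close> a vertex.\<close>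
  have "\<not> (p = 0 \<and> q = 0)" "\<not> (p = 0 \<and> r = 0)" "\<not> (q = 0 \<and> r = 0)"
    using comb sum v(2) by auto
  then consider "0 < p" "0 < q" "0 < r" | "p = 0" "0 < q" "0 < r"
    | "q = 0" "0 < r" "0 < p" | "r = 0" "0 < p" "0 < q" using nn by linarith
  then show ?thesis
  proof cases
    case 1
    then show ?thesis using has_angle_inside[OF D, of v] by (simp add: p_def q_def r_def)
  next
    case 2
    then show ?thesis using has_angle_edge[OF D, of v] by (simp add: p_def q_def r_def)
  next
    case 3
    then show ?thesis using has_angle_edge[of c b a v] D
      by (simp add: p_def q_def r_def det2_rotate insert_commute)
  next
    case 4
    then show ?thesis using has_angle_edge[of a c b v] D
      by (simp add: p_def q_def r_def det2_rotate insert_commute)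
  qed
qed

section \<open>The angle sum of a triangle\<close>

lemma angle_at_bounds:
  assumes "det2 (b - a) (c - a) \<noteq> 0"
  shows "0 < angle_at b a c" "angle_at b a c < pi"
  using arccos_inner(1,2)[OF assms] by (simp_all add: angle_at_def)

text \<open>The addition theorems express the cosine of the sum through inner products of the sides,
  and the expression collapses to -1. The bounds on the single angles then leave only
  \<open>pi\<close>.\<close>

lemma triangle_angle_sum:
  assumes D: "det2 (b - a) (c - a) \<noteq> 0"
  shows "angle_at b a c + angle_at a b c + angle_at a c b = pi"
proof -
  define d where "d = \<bar>det2 (b - a) (c - a)\<bar>"
  define A B C where "A = angle_at b a c" and "B = angle_at a b c" and "C = angle_at a c b"
  have D': "det2 (a - b) (c - b) \<noteq> 0" "det2 (a - c) (b - c) \<noteq> 0"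
    using D by (simp_all add: det2_def algebra_simps)
  have dB: "\<bar>det2 (a - b) (c - b)\<bar> = d" and dC: "\<bar>det2 (a - c) (b - c)\<bar> = d"
    unfolding d_def det2_rotate(2)
    by (simp_all add: det2_def abs_minus_commute[of "(a $ 1 - b $ 1) * (c $ 2 - b $ 2)"] algebra_simps)
  have bounds: "0 < A" "A < pi" "0 < B" "B < pi" "0 < C" "C < pi"
    unfolding A_def B_def C_def using angle_at_bounds D D' by auto
  define x y z where "x = norm (b - a)" and "y = norm (c - b)" and "z = norm (c - a)"
  \<comment> \<open>Entries of the Gram matrix of the two sides at \<open>a\<close>. They determine
    the squared lengths, the other inner products and, as Gram determinant,
    \<open>d\<^sup>2\<close>.\<close>
  define p q r where "p = (b - a) \<bullet> (b - a)" and "q = (c - a) \<bullet> (c - a)" and "r = (b - a) \<bullet> (c - a)"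
  have "b \<noteq> a" "c \<noteq> a" "c \<noteq> b" using D D' by (auto simp: det2_def)
  then have pos: "0 < x" "0 < y" "0 < z" by (auto simp: x_def y_def z_def)
  have sq: "x\<^sup>2 = p" "z\<^sup>2 = q" "y\<^sup>2 = p + q - 2 * r"
    unfolding x_def y_def z_def p_def q_def r_def power2_norm_eq_inner
    by (simp_all add: inner_diff_left inner_diff_right inner_commute)
  have d2: "d\<^sup>2 = p * q - r\<^sup>2"
    using det2_squared[of "b - a" "c - a"]
    unfolding d_def power2_abs p_def q_def r_def power2_norm_eq_inner by simp
  have inner: "(a - b) \<bullet> (c - b) = p - r" "(a - c) \<bullet> (b - c) = q - r"
    unfolding p_def q_def r_def by (simp_all add: inner_diff_left inner_diff_right inner_commute)
  have cosA: "cos A = r / (x * z)" and sinA: "sin A = d / (x * z)"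
    using arccos_inner(3,4)[OF D] by (simp_all add: A_def angle_at_def x_def z_def r_def d_def)
  have cosB: "cos B = (p - r) / (x * y)" and sinB: "sin B = d / (x * y)"
    using arccos_inner(3,4)[OF D'(1)] unfolding inner dB
    by (simp_all add: B_def angle_at_def x_def y_def norm_minus_commute inner)
  have cosC: "cos C = (q - r) / (z * y)" and sinC: "sin C = d / (z * y)"
    using arccos_inner(3,4)[OF D'(2)] unfolding inner dC
    by (simp_all add: C_def angle_at_def z_def y_def norm_minus_commute inner)
  have "cos (A + B + C) = cos A * cos B * cos C - sin A * sin B * cos C - sin A * cos B * sin C
      - cos A * sin B * sin C"
    by (simp add: cos_add sin_add algebra_simps)
  also have "\<dots> = (r * (p - r) * (q - r) - d\<^sup>2 * (q - r) - d\<^sup>2 * (p - r) - d\<^sup>2 * r) / (x\<^sup>2 * y\<^sup>2 * z\<^sup>2)"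
    unfolding cosA cosB cosC sinA sinB sinC
    by (simp add: power2_eq_square mult_ac flip: diff_divide_distrib)
  also have "r * (p - r) * (q - r) - d\<^sup>2 * (q - r) - d\<^sup>2 * (p - r) - d\<^sup>2 * r = - (x\<^sup>2 * y\<^sup>2 * z\<^sup>2)"
    unfolding sq d2 by (simp add: algebra_simps power2_eq_square)
  also have "- (x\<^sup>2 * y\<^sup>2 * z\<^sup>2) / (x\<^sup>2 * y\<^sup>2 * z\<^sup>2) = - 1" using pos by simp
  finally have "cos (A + B + C - pi) = 1" by (simp add: cos_diff)
  then obtain n :: int where "A + B + C - pi = of_int n * (2 * pi)"
    unfolding cos_one_2pi_int by (auto simp: algebra_simps)
  moreover from this have "- 1 * (2 * pi) < of_int n * (2 * pi)" "of_int n * (2 * pi) < 1 * (2 * pi)"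
    using bounds by linarith+
  then have "- 1 < real_of_int n" "real_of_int n < 1" by (simp_all only: mult_less_cancel_right_pos[OF pi_gt_zero[THEN mult_pos_pos[OF zero_less_numeral]]])
  then have "n = 0" by linarith
  ultimately show ?thesis by (simp add: A_def B_def C_def)
qed

subsection \<open>Weighted counts of angles\<close>

lemma between_not_int:
  fixes x :: real and i j :: int
  assumes "of_int i < x" "x < of_int i + 1"
  shows "x \<noteq> of_int j"
proof
  assume "x = of_int j"
  with assms have "i < j" "j < i + 1" by (metis of_int_less_iff, metis of_int_1 of_int_add of_int_less_iff)
  then show False by simp
qed

lemma sum_weights_eq_0:
  fixes l m n :: "'v \<Rightarrow> nat" and p q s :: int
  assumes "(\<Sum>v\<in>V. l v) = (\<Sum>v\<in>V. m v)" "(\<Sum>v\<in>V. m v) = (\<Sum>v\<in>V. n v)" "p + q + s = 0"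
  shows "(\<Sum>v\<in>V. p * int (l v) + q * int (m v) + s * int (n v)) = 0"
proof -
  have "(\<Sum>v\<in>V. p * int (l v) + q * int (m v) + s * int (n v))
      = p * (\<Sum>v\<in>V. int (l v)) + q * (\<Sum>v\<in>V. int (m v)) + s * (\<Sum>v\<in>V. int (n v))"
    by (simp add: sum.distrib sum_distrib_left)
  also have "\<dots> = (p + q + s) * int (\<Sum>v\<in>V. n v)"
    using assms(1,2) by (simp add: algebra_simps flip: of_nat_sum)
  finally show ?thesis using assms(3) by simp
qed

text \<open>Balanced weights sum to zero over all points, so nonnegative values away from the
  corners force a nonpositive corner sum. Every application contradicts this with a positive corner
  sum.\<close>

lemma corner_weights_nonpos:
  fixes l m n :: "'v \<Rightarrow> nat" and p q s :: int
  assumes V: "finite V" "A \<in> V" "B \<in> V" "C \<in> V" "A \<noteq> B" "A \<noteq> C" "B \<noteq> C"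
    and "(\<Sum>v\<in>V. l v) = (\<Sum>v\<in>V. m v)" "(\<Sum>v\<in>V. m v) = (\<Sum>v\<in>V. n v)" "p + q + s = 0"
    and nonneg: "\<And>v. v \<in> V - {A, B, C} \<Longrightarrow> 0 \<le> p * int (l v) + q * int (m v) + s * int (n v)"
  shows "(p * int (l A) + q * int (m A) + s * int (n A)) + (p * int (l B) + q * int (m B) + s * int (n B))
    + (p * int (l C) + q * int (m C) + s * int (n C)) \<le> 0"
proof -
  define f where "f v = p * int (l v) + q * int (m v) + s * int (n v)" for v
  have "0 = sum f V"
    using sum_weights_eq_0[OF assms(8-10)] by (simp add: f_def)
  also have "\<dots> = sum f (V - {A, B, C}) + sum f {A, B, C}"
    using V by (intro sum.subset_diff) auto
  also have "sum f {A, B, C} = f A + f B + f C" using V by simp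
  finally have "f A + f B + f C = - sum f (V - {A, B, C})" by simp
  also have "\<dots> \<le> 0" using nonneg by (auto simp: f_def intro!: sum_nonneg)
  finally show ?thesis by (simp add: f_def)
qed

text \<open>Applied at the corner of smallest angle, which cannot be split when the other two angles
  are strictly larger.\<close>

lemma nat_combination_eq_1:
  fixes x y :: real
  assumes "1 < x" "1 < y" "real l + real m * x + real n * y = 1"
  shows "l = 1 \<and> m = 0 \<and> n = 0"
proof -
  have "m = 0"
  proof (rule ccontr)
    assume "m \<noteq> 0"
    then have "x \<le> real m * x" using assms(1) by simp
    moreover have "0 \<le> real n * y" using assms(2) by simp
    ultimately show False using assms by linarith
  qed
  moreover have "n = 0"
  proof (rule ccontr)
    assume "n \<noteq> 0"
    then have "y \<le> real n * y" using assms by simp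
    moreover have "0 \<le> real m * x" using assms by simp
    ultimately show False using assms by linarith
  qed
  ultimately show ?thesis using assms(3) by simp
qed

section \<open>Two equal angles, each \<open>k\<close> times the smallest\<close>

lemma isosceles_corner:
  fixes k l m n :: nat
  assumes k: "k \<ge> 3" and eq: "l + m * k + n * k = k"
  shows "(l = k \<and> m = 0 \<and> n = 0) \<or> (l = 0 \<and> m + n = 1)"
proof -
  have e: "l + (m + n) * k = k" using eq by (simp add: algebra_simps)
  have "m + n \<le> 1"
  proof (rule ccontr)
    assume "\<not> m + n \<le> 1"
    then have "2 * k \<le> (m + n) * k" by (intro mult_right_mono) auto
    then show False using e k by linarith
  qed
  then consider "m + n = 0" | "m + n = 1" by linarith
  then show ?thesis using e by cases auto
qed

text \<open>\<open>2 * k + 1\<close> and \<open>4 * k + 2\<close> are pi and 2 pi in units of the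
  smallest angle. At most four large angles fit; equality holds for one small and two large angles
  and for twice that.\<close>

lemma isosceles_weight:
  fixes k l m n :: nat
  assumes k: "k \<ge> 3" and eq: "l + m * k + n * k = 2 * k + 1 \<or> l + m * k + n * k = 4 * k + 2"
  shows "m + n \<le> 2 * l"
proof -
  define y where "y = m + n"
  have e: "l + y * k = 2 * k + 1 \<or> l + y * k = 4 * k + 2" using eq by (simp add: algebra_simps y_def)
  have "y \<le> 4"
  proof (rule ccontr)
    assume "\<not> y \<le> 4"
    then have "5 * k \<le> y * k" by (intro mult_right_mono) auto
    then show False using e k by linarith
  qed
  then consider "y = 0" | "y = 1" | "y = 2" | "y = 3" | "y = 4" by linarith
  then show ?thesis unfolding y_def[symmetric] using e k by cases auto
qed

text \<open>The smallest angle is the unit. In the \<open>long\<close> lemmas the angles are \<open>(1, x, k)\<close>: the largest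
  angle of the triangle is split into \<open>k\<close> copies of the smallest one. In the \<open>medium\<close> lemmas they are
  \<open>(1, k, x)\<close>: the middle angle is split.\<close>

lemma long_corner:
  fixes x :: real and k l m n :: nat
  assumes k: "k \<ge> 3" and x: "real k - 1 < x" "x < real k"
    and eq: "real l + real m * x + real n * real k = x"
  shows "l = 0 \<and> m = 1 \<and> n = 0"
proof -
  have nint: "x \<noteq> of_int j" for j
    by (rule between_not_int[of "int k - 1"]) (use x in auto)
  have "n = 0"
  proof (rule ccontr)
    assume "n \<noteq> 0"
    then have "real k \<le> real n * real k" by (simp add: mult_le_cancel_right1)
    moreover have "0 \<le> real m * x" using x k by simp
    ultimately show False using eq x by linarith
  qed
  moreover have "m \<le> 1"
  proof (rule ccontr)
    assume "\<not> m \<le> 1"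
    then have "2 * x \<le> real m * x" using x k by (intro mult_right_mono) auto
    moreover have "real l + real m * x = x" using eq \<open>n = 0\<close> by simp
    ultimately show False using x k by linarith
  qed
  moreover have "m \<noteq> 0" using eq \<open>n = 0\<close> nint[of "int l"] by (cases "m = 0") auto
  ultimately have "n = 0" "m = 1" by auto
  then show ?thesis using eq by simp
qed

text \<open>\<open>(real m - 1) * x\<close> is an integer while \<open>x\<close> is not, which
  excludes \<open>m = 0\<close> and \<open>m = 2\<close>; size excludes
  \<open>m \<ge> 3\<close>.\<close>

lemma long_straight:
  fixes x :: real and k l m n :: nat
  assumes k: "k \<ge> 3" and x: "real k - 1 < x" "x < real k"
    and eq: "real l + real m * x + real n * real k = 1 + x + real k"
  shows "m = 1 \<and> l + n * k = k + 1"
proof -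
  have nint: "x \<noteq> of_int j" for j
    by (rule between_not_int[of "int k - 1"]) (use x in auto)
  have e: "(real m - 1) * x = of_int (1 + int k - int l - int n * int k)"
    using eq by (simp add: algebra_simps)
  have "m \<noteq> 0"
    using e nint[of "- (1 + int k - int l - int n * int k)"] by (cases "m = 0") auto
  moreover have "m \<noteq> 2" using e nint[of "1 + int k - int l - int n * int k"] by auto
  moreover have "m < 3"
  proof (rule ccontr)
    assume "\<not> m < 3"
    then have "2 * x \<le> (real m - 1) * x" using x k by (intro mult_right_mono) auto
    moreover have "(real m - 1) * x \<le> 1 + real k"
      using e by (simp add: add_nonneg_nonneg flip: of_nat_mult of_nat_add)
    ultimately show False using x k by linarith
  qed
  ultimately have m: "m = 1" by linarith
  then have "real (l + n * k) = real (k + 1)" using eq by simp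
  then show ?thesis using m by (simp only: of_nat_eq_iff)
qed

text \<open>\<open>(real m - 2) * x\<close> is an integer and size forces \<open>m < 6\<close>. A
  non-integral \<open>x\<close> excludes \<open>m = 1\<close> and \<open>m = 3\<close>; the values 0
  and 4 need a half-integer, and 5 needs \<open>3 * x\<close> to be an integer.\<close>

lemma long_full:
  fixes x :: real and k l m n :: nat
  assumes k: "k \<ge> 3" and x: "real k - 1 < x" "x < real k"
    and eq: "real l + real m * x + real n * real k = 2 * (1 + x + real k)"
  shows "(m = 2 \<and> l + n * k = 2 * k + 2)
    \<or> (2 * x = 2 * real k - 1 \<and> (m = 0 \<and> l + n * k = 4 * k + 1 \<or> m = 4 \<and> l + n * k = 3))
    \<or> (2 * x \<noteq> 2 * real k - 1 \<and> m = 5 \<and> n = 0)"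
proof -
  have nint: "x \<noteq> of_int j" for j
    by (rule between_not_int[of "int k - 1"]) (use x in auto)
  have half: "2 * x = 2 * real k - 1" if "2 * x = of_int j" for j
  proof -
    have "of_int (2 * int k - 2) < (of_int j :: real)" "(of_int j :: real) < of_int (2 * int k)"
      using that x by auto
    then have "j = 2 * int k - 1" by (simp only: of_int_less_iff)
    then show ?thesis using that by simp
  qed
  define t where "t = 2 + 2 * int k - int l - int n * int k"
  have e: "(real m - 2) * x = of_int t"
    using eq by (simp add: algebra_simps t_def)
  have "m < 6"
  proof (rule ccontr)
    assume "\<not> m < 6"
    then have "4 * x \<le> (real m - 2) * x" using x k by (intro mult_right_mono) auto
    moreover have "of_int t \<le> 2 + 2 * real k"
      by (simp add: t_def add_nonneg_nonneg flip: of_nat_mult of_nat_add)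
    ultimately show False using x k e by linarith
  qed
  then consider "m = 0" | "m = 1" | "m = 2" | "m = 3" | "m = 4" | "m = 5" by linarith
  then show ?thesis
  proof cases
    case 1
    then have h: "2 * x = 2 * real k - 1" using e half[of "- t"] by auto
    then have "real (l + n * k) = real (4 * k + 1)" using eq 1 by simp
    then show ?thesis using h 1 by (simp only: of_nat_eq_iff) simp
  next
    case 2
    then show ?thesis using e nint[of "- t"] by auto
  next
    case 3
    then have "real (l + n * k) = real (2 * k + 2)" using eq by simp
    then show ?thesis using 3 by (simp only: of_nat_eq_iff) simp
  next
    case 4
    then show ?thesis using e nint[of t] by auto
  next
    case 5
    then have h: "2 * x = 2 * real k - 1" using e half[of t] by auto
    then have "real (l + n * k) = real 3" using eq 5 by simp
    then show ?thesis using h 5 by (simp only: of_nat_eq_iff) simp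
  next
    case 6
    have e3: "3 * x = of_int t" using e 6 by simp
    \<comment> \<open>For a half-integer \<open>x\<close> the even number \<open>2 * t\<close> would
      be odd.\<close>
    have "2 * x \<noteq> 2 * real k - 1"
    proof
      assume "2 * x = 2 * real k - 1"
      then have "of_int (2 * t) = (of_int (3 * (2 * int k - 1)) :: real)" using e3 by simp
      then have "2 * t = 3 * (2 * int k - 1)" by (simp only: of_int_eq_iff)
      then show False by presburger
    qed
    moreover have "n = 0"
    proof (rule ccontr)
      assume "n \<noteq> 0"
      then have "int k \<le> int n * int k" by (simp add: mult_le_cancel_right1)
      then have "t \<le> 2 + int k" by (simp add: t_def)
      then have "of_int t \<le> 2 + real k" by linarith
      then show False using e3 x k by linarith
    qed
    ultimately show ?thesis using 6 by simp
  qed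
qed

lemma medium_corner:
  fixes x :: real and k l m n :: nat
  assumes k: "k \<ge> 3" and x: "real k < x" "x < real k + 1"
    and eq: "real l + real m * real k + real n * x = x"
  shows "l = 0 \<and> m = 0 \<and> n = 1"
proof -
  have nint: "x \<noteq> of_int j" for j
    by (rule between_not_int[of "int k"]) (use x in auto)
  have "n \<le> 1"
  proof (rule ccontr)
    assume "\<not> n \<le> 1"
    then have "2 * x \<le> real n * x" using x k by (intro mult_right_mono) auto
    moreover have "0 \<le> real m * real k" by simp
    ultimately show False using eq x k by linarith
  qed
  moreover have "n \<noteq> 0" using eq nint[of "int l + int m * int k"] by (cases "n = 0") auto
  ultimately have n: "n = 1" by auto
  then have "real (l + m * k) = real 0" using eq by simp
  then show ?thesis using n k by (simp only: of_nat_eq_iff) simp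
qed

lemma medium_straight:
  fixes x :: real and k l m n :: nat
  assumes k: "k \<ge> 3" and x: "real k < x" "x < real k + 1"
    and eq: "real l + real m * real k + real n * x = 1 + real k + x"
  shows "n = 1 \<and> l + m * k = k + 1"
proof -
  have nint: "x \<noteq> of_int j" for j
    by (rule between_not_int[of "int k"]) (use x in auto)
  have e: "(real n - 1) * x = of_int (1 + int k - int l - int m * int k)"
    using eq by (simp add: algebra_simps)
  have "n \<noteq> 0"
    using e nint[of "- (1 + int k - int l - int m * int k)"] by (cases "n = 0") auto
  moreover have "n \<noteq> 2" using e nint[of "1 + int k - int l - int m * int k"] by auto
  moreover have "n < 3"
  proof (rule ccontr)
    assume "\<not> n < 3"
    then have "2 * x \<le> (real n - 1) * x" using x k by (intro mult_right_mono) auto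
    moreover have "(real n - 1) * x \<le> 1 + real k"
      using e by (simp add: add_nonneg_nonneg flip: of_nat_mult of_nat_add)
    ultimately show False using x k by linarith
  qed
  ultimately have n: "n = 1" by linarith
  then have "real (l + m * k) = real (k + 1)" using eq by simp
  then show ?thesis using n by (simp only: of_nat_eq_iff)
qed

text \<open>As in \<open>long_full\<close>, but now \<open>x\<close> exceeds \<open>k\<close>, so
  already \<open>3 * x\<close> is larger than \<open>2 + 2 * real k\<close> and no case with thirds
  arises.\<close>

lemma medium_full:
  fixes x :: real and k l m n :: nat
  assumes k: "k \<ge> 3" and x: "real k < x" "x < real k + 1"
    and eq: "real l + real m * real k + real n * x = 2 * (1 + real k + x)"
  shows "(n = 2 \<and> l + m * k = 2 * k + 2)
    \<or> (2 * x = 2 * real k + 1 \<and> (n = 0 \<and> l + m * k = 4 * k + 3 \<or> n = 4 \<and> l + m * k = 1))"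
proof -
  have nint: "x \<noteq> of_int j" for j
    by (rule between_not_int[of "int k"]) (use x in auto)
  have half: "2 * x = 2 * real k + 1" if "2 * x = of_int j" for j
  proof -
    have "of_int (2 * int k) < (of_int j :: real)" "(of_int j :: real) < of_int (2 * int k + 2)"
      using that x by auto
    then have "j = 2 * int k + 1" by (simp only: of_int_less_iff)
    then show ?thesis using that by simp
  qed
  define t where "t = 2 + 2 * int k - int l - int m * int k"
  have e: "(real n - 2) * x = of_int t"
    using eq by (simp add: algebra_simps t_def)
  have "n < 5"
  proof (rule ccontr)
    assume "\<not> n < 5"
    then have "3 * x \<le> (real n - 2) * x" using x k by (intro mult_right_mono) auto
    moreover have "of_int t \<le> 2 + 2 * real k"
      by (simp add: t_def add_nonneg_nonneg flip: of_nat_mult of_nat_add)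
    ultimately show False using x k e by linarith
  qed
  then consider "n = 0" | "n = 1" | "n = 2" | "n = 3" | "n = 4" by linarith
  then show ?thesis
  proof cases
    case 1
    then have h: "2 * x = 2 * real k + 1" using e half[of "- t"] by auto
    then have "real (l + m * k) = real (4 * k + 3)" using eq 1 by simp
    then show ?thesis using h 1 by (simp only: of_nat_eq_iff) simp
  next
    case 2
    then show ?thesis using e nint[of "- t"] by auto
  next
    case 3
    then have "real (l + m * k) = real (2 * k + 2)" using eq by simp
    then show ?thesis using 3 by (simp only: of_nat_eq_iff) simp
  next
    case 4
    then show ?thesis using e nint[of t] by auto
  next
    case 5
    then have h: "2 * x = 2 * real k + 1" using e half[of t] by auto
    then have "real (l + m * k) = real 1" using eq 5 by simp
    then show ?thesis using h 5 by (simp only: of_nat_eq_iff) simp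
  qed
qed

section \<open>Nonnegative weights away from the corners\<close>

lemma weight_generic:
  fixes k l n :: nat
  assumes "k \<ge> 3" "l + n * k = k + 1 \<or> l + n * k = 2 * k + 2"
  shows "n \<le> l"
proof -
  have "n \<le> 2"
  proof (rule ccontr)
    assume "\<not> n \<le> 2"
    then have "3 * k \<le> n * k" by (intro mult_right_mono) auto
    then show False using assms by linarith
  qed
  \<comment> \<open>The solutions \<open>(l, n)\<close> are (k + 1, 0) and (1, 1) for the first
    equation, and (2k + 2, 0), (k + 2, 1) and (2, 2) for the second.\<close>
  then consider "n = 0" | "n = 1" | "n = 2" by linarith
  then show ?thesis using assms by cases auto
qed

text \<open>Nonnegativity of the weights (4, -3, -1), with \<open>j\<close> the count of the split
  angle. The first two inequalities serve the long case, where the middle angle occurs once or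
  twice; the last two serve the medium case, where the largest angle does.\<close>

lemma weight_half_integer:
  fixes k l j :: nat
  assumes "k \<ge> 3" "l + j * k = k + 1 \<or> l + j * k = 2 * k + 2"
  shows "j \<le> 2" "l + j * k = k + 1 \<Longrightarrow> 3 + j \<le> 4 * l"
    "l + j * k = 2 * k + 2 \<Longrightarrow> 6 + j \<le> 4 * l" "l + j * k = k + 1 \<Longrightarrow> 1 + 3 * j \<le> 4 * l"
    "l + j * k = 2 * k + 2 \<Longrightarrow> 2 + 3 * j \<le> 4 * l"
proof -
  show j: "j \<le> 2"
  proof (rule ccontr)
    assume "\<not> j \<le> 2"
    then have "3 * k \<le> j * k" by (intro mult_right_mono) auto
    then show False using assms by linarith
  qed
  then consider "j = 0" | "j = 1" | "j = 2" by linarith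
  note c = this
  show "l + j * k = k + 1 \<Longrightarrow> 3 + j \<le> 4 * l" using c assms(1) by cases auto
  show "l + j * k = 2 * k + 2 \<Longrightarrow> 6 + j \<le> 4 * l" using c assms(1) by cases auto
  show "l + j * k = k + 1 \<Longrightarrow> 1 + 3 * j \<le> 4 * l" using c assms(1) by cases auto
  show "l + j * k = 2 * k + 2 \<Longrightarrow> 2 + 3 * j \<le> 4 * l" using c assms(1) by cases auto
qed

text \<open>The tight triples \<open>(l, m, n)\<close> are (1, 0, 4) and (3, 4, 0); with sum zero
  they determine the weights (4, -3, -1) up to scaling. For \<open>k = 3\<close> the triple (0, 4,
  1) would violate the bound.\<close>

lemma long_weight_half_integer:
  fixes k l m n :: nat
  assumes k: "k \<ge> 4" and "m = 0 \<and> l + n * k = 4 * k + 1 \<or> m = 4 \<and> l + n * k = 3"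
  shows "3 * m + n \<le> 4 * l"
  using assms(2)
proof
  assume a: "m = 0 \<and> l + n * k = 4 * k + 1"
  have "n \<le> 4"
  proof (rule ccontr)
    assume "\<not> n \<le> 4"
    then have "5 * k \<le> n * k" by (intro mult_right_mono) auto
    then show False using a k by linarith
  qed
  then consider "n = 0" | "n = 1" | "n = 2" | "n = 3" | "n = 4" by linarith
  then show ?thesis using a k by cases auto
next
  assume a: "m = 4 \<and> l + n * k = 3"
  have "n = 0"
  proof (rule ccontr)
    assume "n \<noteq> 0"
    then have "k \<le> n * k" by simp
    then show False using a k by linarith
  qed
  then show ?thesis using a by simp
qed

text \<open>Here (3, 4, 0) and (1, 0, 4) are tight, which gives the same weights. For
  \<open>k = 3\<close> five middle angles fill 2 pi, and (0, 5, 0) would violate the bound.\<close>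

lemma medium_weight_half_integer:
  fixes k l m n :: nat
  assumes k: "k \<ge> 4" and "n = 0 \<and> l + m * k = 4 * k + 3 \<or> n = 4 \<and> l + m * k = 1"
  shows "3 * m + n \<le> 4 * l"
  using assms(2)
proof
  assume a: "n = 0 \<and> l + m * k = 4 * k + 3"
  have "m \<le> 4"
  proof (rule ccontr)
    assume "\<not> m \<le> 4"
    then have "5 * k \<le> m * k" by (intro mult_right_mono) auto
    then show False using a k by linarith
  qed
  then consider "m = 0" | "m = 1" | "m = 2" | "m = 3" | "m = 4" by linarith
  then show ?thesis using a k by cases auto
next
  assume a: "n = 4 \<and> l + m * k = 1"
  have "m = 0"
  proof (rule ccontr)
    assume "m \<noteq> 0"
    then have "k \<le> m * k" by simp
    then show False using a k by linarith
  qed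
  then show ?thesis using a by simp
qed


text \<open>The arithmetic that remains of a tiling. The angles are left unordered so that their
  roles can be permuted. The value \<open>pi\<close> covers points on the boundary of the big
  triangle as well as interior points lying inside an edge of a tile.\<close>

definition vertex_count ::
  "'v set \<Rightarrow> nat \<Rightarrow> 'v \<Rightarrow> 'v \<Rightarrow> 'v \<Rightarrow> real \<Rightarrow> real \<Rightarrow> real \<Rightarrow>
   ('v \<Rightarrow> nat) \<Rightarrow> ('v \<Rightarrow> nat) \<Rightarrow> ('v \<Rightarrow> nat) \<Rightarrow> bool" where
  "vertex_count V k A B C \<alpha> \<beta> \<gamma> l m n \<longleftrightarrow>
     finite V \<and> A \<in> V \<and> B \<in> V \<and> C \<in> V \<and> A \<noteq> B \<and> A \<noteq> C \<and> B \<noteq> C \<and>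
     (\<Sum>v\<in>V. l v) = (\<Sum>v\<in>V. m v) \<and> (\<Sum>v\<in>V. m v) = (\<Sum>v\<in>V. n v) \<and>
     0 < \<alpha> \<and> 0 < \<beta> \<and> 0 < \<gamma> \<and> \<alpha> < pi / 2 \<and> \<beta> < pi / 2 \<and> \<gamma> < pi / 2 \<and> \<alpha> + \<beta> + \<gamma> = pi \<and>
     real (l A) * \<alpha> + real (m A) * \<beta> + real (n A) * \<gamma> = \<alpha> \<and>
     real (l B) * \<alpha> + real (m B) * \<beta> + real (n B) * \<gamma> = \<beta> \<and>
     real (l C) * \<alpha> + real (m C) * \<beta> + real (n C) * \<gamma> = \<gamma> \<and>
     (\<forall>v\<in>V - {A, B, C}. real (l v) * \<alpha> + real (m v) * \<beta> + real (n v) * \<gamma> \<in> {pi, 2 * pi}) \<and>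
     (\<exists>v\<in>{A, B, C}. l v + m v + n v = k)"

section \<open>Classification of the vertex counts\<close>

lemma vertex_count_swap12:
  "vertex_count V k A B C \<alpha> \<beta> \<gamma> l m n \<Longrightarrow> vertex_count V k B A C \<beta> \<alpha> \<gamma> m l n"
  unfolding vertex_count_def by (auto simp: insert_commute add_ac)

lemma vertex_count_swap23:
  "vertex_count V k A B C \<alpha> \<beta> \<gamma> l m n \<Longrightarrow> vertex_count V k A C B \<alpha> \<gamma> \<beta> l n m"
  unfolding vertex_count_def by (auto simp: insert_commute add_ac)

lemma vertex_count_sorted:
  assumes vc: "vertex_count V k A B C \<alpha> \<beta> \<gamma> l m n" and k: "k \<ge> 3"
    and le: "\<alpha> \<le> \<beta>" "\<beta> \<le> \<gamma>"
  shows "k = 3 \<and> (\<alpha> = 2 / 13 * pi \<and> \<beta> = 5 / 13 * pi \<and> \<gamma> = 6 / 13 * pi \<or>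
                  \<alpha> = 2 / 15 * pi \<and> \<beta> = 6 / 15 * pi \<and> \<gamma> = 7 / 15 * pi)"
proof -
  define b g where "b = \<beta> / \<alpha>" and "g = \<gamma> / \<alpha>"
  have pos: "0 < \<alpha>" and lt: "\<gamma> < pi / 2" and sum: "\<alpha> + \<beta> + \<gamma> = pi"
    using vc by (auto simp: vertex_count_def)
  have bg: "\<beta> = b * \<alpha>" "\<gamma> = g * \<alpha>" using pos by (simp_all add: b_def g_def)
  have scale: "real i + real j * b + real h * g = s"
    if "real i * \<alpha> + real j * \<beta> + real h * \<gamma> = s * \<alpha>" for i j h s
  proof -
    have "(real i + real j * b + real h * g) * \<alpha> = s * \<alpha>"
      using that by (simp add: bg algebra_simps)
    then show ?thesis using pos by simp
  qed
  have pi_eq: "pi = (1 + b + g) * \<alpha>" using sum by (simp add: bg algebra_simps)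
  have b1: "1 \<le> b" and bleg: "b \<le> g" using le pos by (simp_all add: bg)
  \<comment> \<open>The only use of acuteness in the arithmetic: it keeps the largest angle below
    the sum of the other two.\<close>
  have "\<gamma> < \<alpha> + \<beta>" using lt sum by linarith
  then have "g * \<alpha> < (1 + b) * \<alpha>" by (simp add: bg algebra_simps)
  then have gb: "g < 1 + b" using pos by simp
  have cA: "real (l A) + real (m A) * b + real (n A) * g = 1"
    using vc by (intro scale) (simp add: vertex_count_def)
  have cB: "real (l B) + real (m B) * b + real (n B) * g = b"
    using vc by (intro scale) (simp add: vertex_count_def flip: bg)
  have cC: "real (l C) + real (m C) * b + real (n C) * g = g"
    using vc by (intro scale) (simp add: vertex_count_def flip: bg)
  have other: "real (l v) + real (m v) * b + real (n v) * g = 1 + b + g \<or>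
      real (l v) + real (m v) * b + real (n v) * g = 2 * (1 + b + g)" if "v \<in> V - {A, B, C}" for v
  proof -
    have "real (l v) * \<alpha> + real (m v) * \<beta> + real (n v) * \<gamma> \<in> {pi, 2 * pi}"
      using vc that unfolding vertex_count_def by blast
    then consider "real (l v) * \<alpha> + real (m v) * \<beta> + real (n v) * \<gamma> = pi"
      | "real (l v) * \<alpha> + real (m v) * \<beta> + real (n v) * \<gamma> = 2 * pi" by auto
    then show ?thesis
    proof cases
      case 1
      then show ?thesis unfolding pi_eq by (intro disjI1 scale)
    next
      case 2
      then have "real (l v) * \<alpha> + real (m v) * \<beta> + real (n v) * \<gamma> = (2 * (1 + b + g)) * \<alpha>"
        using pi_eq by (simp add: algebra_simps)
      then show ?thesis by (intro disjI2 scale)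
    qed
  qed
  have weights: "(p * int (l A) + q * int (m A) + s * int (n A))
      + (p * int (l B) + q * int (m B) + s * int (n B))
      + (p * int (l C) + q * int (m C) + s * int (n C)) \<le> 0"
    if "p + q + s = 0"
      "\<And>v. v \<in> V - {A, B, C} \<Longrightarrow> 0 \<le> p * int (l v) + q * int (m v) + s * int (n v)" for p q s
    using vc that by (intro corner_weights_nonpos) (auto simp: vertex_count_def)
  obtain v where v: "v \<in> {A, B, C}" "l v + m v + n v = k"
    using vc by (auto simp: vertex_count_def)
  have v_le: "real (l v) + real (m v) * b + real (n v) * g \<le> g"
    using v(1) cA cB cC b1 bleg by auto
  \<comment> \<open>Of the \<open>k\<close> angles at \<open>v\<close> each is at least 1. If one
    were at least \<open>b\<close>, their sum would be at least \<open>k - 1 + b\<close>, beyond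
    \<open>g < 1 + b\<close>. So the corner is split into smallest angles only.\<close>
  have "m v + n v = 0"
  proof (rule ccontr)
    assume "m v + n v \<noteq> 0"
    then have "1 \<le> real (m v + n v)" by linarith
    then have "0 \<le> (real (m v + n v) - 1) * (b - 1)" using b1 by (intro mult_nonneg_nonneg) auto
    then have "real (l v + (m v + n v)) - 1 + b \<le> real (l v) + real (m v + n v) * b"
      by (simp add: algebra_simps)
    also have "\<dots> \<le> real (l v) + real (m v) * b + real (n v) * g"
      using bleg by (simp add: distrib_right mult_left_mono)
    also have "\<dots> \<le> g" by (fact v_le)
    finally have "real k - 1 + b \<le> g" using v(2) by (simp add: add.assoc)
    then show False using k gb by linarith
  qed
  then have v0: "m v = 0" "n v = 0" "l v = k" using v(2) by auto
  have vA: "v \<noteq> A" using cA v0 k by auto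
  then consider (iso) "b = k" "g = k" | (long) "v = C" "g = k" "b < k" | (medium) "v = B" "b = k" "k < g"
    using v(1) cB cC v0 bleg by fastforce
  then show ?thesis
  proof cases
    case iso
    have nat_eq: "l w + m w * k + n w * k = r"
      if "real (l w) + real (m w) * b + real (n w) * g = real r" for w r
    proof -
      have "real (l w + m w * k + n w * k) = real r" using that iso by simp
      then show ?thesis by (simp only: of_nat_eq_iff)
    qed
    have A: "l A = 1" "m A = 0" "n A = 0"
      using nat_combination_eq_1[OF _ _ cA] iso k by auto
    have cor: "l w = k \<and> m w = 0 \<and> n w = 0 \<or> l w = 0 \<and> m w + n w = 1" if "w \<in> {B, C}" for w
      using that cB cC iso by (intro isosceles_corner[OF k] nat_eq) auto
    have "0 \<le> 2 * int (l w) + (-1) * int (m w) + (-1) * int (n w)" if "w \<in> V - {A, B, C}" for w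
    proof -
      have "m w + n w \<le> 2 * l w"
        using other[OF that] iso by (intro isosceles_weight[OF k]) (auto intro!: nat_eq)
      then show ?thesis by linarith
    qed
    note W = weights[OF _ this]
    \<comment> \<open>The split corner contributes \<open>2 * k\<close>, the corner \<open>A\<close>
      contributes 2 and the third one at least -1, a positive sum.\<close>
    have "v \<in> {B, C}" using v(1) vA by auto
    then have False using W A cor[of B] cor[of C] v0 k by auto
    then show ?thesis ..
  next
    case long
    have x: "real k - 1 < b" "b < real k" using long gb by auto
    have A: "l A = 1" "m A = 0" "n A = 0"
      using nat_combination_eq_1[OF _ _ cA] x long k by auto
    have B: "l B = 0" "m B = 1" "n B = 0"
      using long_corner[OF k x, of "l B" "m B" "n B"] cB long by auto
    have C: "l C = k" "m C = 0" "n C = 0" using v0 long by auto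
    have oth: "m w = 1 \<and> l w + n w * k = k + 1 \<or> m w = 2 \<and> l w + n w * k = 2 * k + 2
        \<or> (2 * b = 2 * real k - 1 \<and> (m w = 0 \<and> l w + n w * k = 4 * k + 1 \<or> m w = 4 \<and> l w + n w * k = 3))
        \<or> (2 * b \<noteq> 2 * real k - 1 \<and> m w = 5 \<and> n w = 0)" if "w \<in> V - {A, B, C}" for w
      using other[OF that] long_straight[OF k x, of "l w" "m w" "n w"]
        long_full[OF k x, of "l w" "m w" "n w"] long by auto
    have half: "2 * b = 2 * real k - 1"
    proof (rule ccontr)
      assume nh: "2 * b \<noteq> 2 * real k - 1"
      \<comment> \<open>The weights ignore the middle angle; the corners contribute 1, 0 and
        \<open>k\<close>.\<close>
      have "0 \<le> 1 * int (l w) + 0 * int (m w) + (-1) * int (n w)" if "w \<in> V - {A, B, C}" for w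
        using oth[OF that] nh weight_generic[OF k, of "l w" "n w"] by auto
      note W = weights[OF _ this]
      show False using W A B C by auto
    qed
    have "k = 3"
    proof (rule ccontr)
      assume "k \<noteq> 3"
      then have k4: "k \<ge> 4" using k by simp
      \<comment> \<open>The corners contribute 4, -3 and \<open>4 * k\<close>. Having
        \<open>half\<close> removes the solutions with five middle angles.\<close>
      have "0 \<le> 4 * int (l w) + (-3) * int (m w) + (-1) * int (n w)" if "w \<in> V - {A, B, C}" for w
        using oth[OF that] half weight_half_integer(2,3)[OF k, of "l w" "n w"]
          long_weight_half_integer[OF k4, of "m w" "l w" "n w"] by auto
      note W = weights[OF _ this]
      show False using W A B C k by auto
    qed
    then have bg_val: "b = 5 / 2" "g = 3" using half long by auto
    then have "\<alpha> = 2 / 13 * pi" using pi_eq unfolding bg_val by simp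
    then show ?thesis using \<open>k = 3\<close> unfolding bg bg_val by simp
  next
    case medium
    have x: "real k < g" "g < real k + 1" using medium gb by auto
    have A: "l A = 1" "m A = 0" "n A = 0"
      using nat_combination_eq_1[OF _ _ cA] x medium k by auto
    have B: "l B = k" "m B = 0" "n B = 0" using v0 medium by auto
    have C: "l C = 0" "m C = 0" "n C = 1"
      using medium_corner[OF k x, of "l C" "m C" "n C"] cC medium by auto
    have oth: "n w = 1 \<and> l w + m w * k = k + 1 \<or> n w = 2 \<and> l w + m w * k = 2 * k + 2
        \<or> (2 * g = 2 * real k + 1 \<and> (n w = 0 \<and> l w + m w * k = 4 * k + 3 \<or> n w = 4 \<and> l w + m w * k = 1))"
      if "w \<in> V - {A, B, C}" for w
      using other[OF that] medium_straight[OF k x, of "l w" "m w" "n w"]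
        medium_full[OF k x, of "l w" "m w" "n w"] medium by auto
    have half: "2 * g = 2 * real k + 1"
    proof (rule ccontr)
      assume nh: "2 * g \<noteq> 2 * real k + 1"
      \<comment> \<open>Now the weights ignore the largest angle; the corners contribute 1,
        \<open>k\<close> and 0.\<close>
      have "0 \<le> 1 * int (l w) + (-1) * int (m w) + 0 * int (n w)" if "w \<in> V - {A, B, C}" for w
        using oth[OF that] nh weight_generic[OF k, of "l w" "m w"] by auto
      note W = weights[OF _ this]
      show False using W A B C by auto
    qed
    have "k = 3"
    proof (rule ccontr)
      assume "k \<noteq> 3"
      then have k4: "k \<ge> 4" using k by simp
      \<comment> \<open>The corners contribute 4, \<open>4 * k\<close> and -1.\<close>
      have "0 \<le> 4 * int (l w) + (-3) * int (m w) + (-1) * int (n w)" if "w \<in> V - {A, B, C}" for w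
        using oth[OF that] half weight_half_integer(4,5)[OF k, of "l w" "m w"]
          medium_weight_half_integer[OF k4, of "n w" "l w" "m w"] by auto
      note W = weights[OF _ this]
      show False using W A B C k by auto
    qed
    then have bg_val: "b = 3" "g = 7 / 2" using half medium by auto
    then have "\<alpha> = 2 / 15 * pi" using pi_eq unfolding bg_val by simp
    then show ?thesis using \<open>k = 3\<close> unfolding bg bg_val by simp
  qed
qed

theorem vertex_count_classification:
  assumes vc: "vertex_count V k A B C \<alpha> \<beta> \<gamma> l m n" and k: "k \<ge> 3"
  shows "k = 3 \<and> ({#\<alpha>, \<beta>, \<gamma>#} = {# 2 / 13 * pi, 5 / 13 * pi, 6 / 13 * pi #} \<or>
                  {#\<alpha>, \<beta>, \<gamma>#} = {# 2 / 15 * pi, 6 / 15 * pi, 7 / 15 * pi #})"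
proof -
  have sorted: "k = 3 \<and> ({#x, y, z#} = {# 2 / 13 * pi, 5 / 13 * pi, 6 / 13 * pi #} \<or>
                  {#x, y, z#} = {# 2 / 15 * pi, 6 / 15 * pi, 7 / 15 * pi #})"
    if "vertex_count V k A B C x y z l m n" "x \<le> y" "y \<le> z" for A B C x y z l m n
    using vertex_count_sorted[OF that(1) k that(2,3)] by metis
  note s12 = vertex_count_swap12 and s23 = vertex_count_swap23
  have perm: "{#\<beta>, \<alpha>, \<gamma>#} = {#\<alpha>, \<beta>, \<gamma>#}" "{#\<alpha>, \<gamma>, \<beta>#} = {#\<alpha>, \<beta>, \<gamma>#}"
    "{#\<beta>, \<gamma>, \<alpha>#} = {#\<alpha>, \<beta>, \<gamma>#}" "{#\<gamma>, \<alpha>, \<beta>#} = {#\<alpha>, \<beta>, \<gamma>#}" "{#\<gamma>, \<beta>, \<alpha>#} = {#\<alpha>, \<beta>, \<gamma>#}"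
    by (simp_all add: add_mset_commute)
  consider "\<alpha> \<le> \<beta>" "\<beta> \<le> \<gamma>" | "\<beta> \<le> \<alpha>" "\<alpha> \<le> \<gamma>" | "\<alpha> \<le> \<gamma>" "\<gamma> \<le> \<beta>"
    | "\<beta> \<le> \<gamma>" "\<gamma> \<le> \<alpha>" | "\<gamma> \<le> \<alpha>" "\<alpha> \<le> \<beta>" | "\<gamma> \<le> \<beta>" "\<beta> \<le> \<alpha>" by linarith
  then show ?thesis
  proof cases
    case 1 then show ?thesis using sorted[OF vc] by simp
  next
    case 2 then show ?thesis using sorted[OF s12[OF vc]] unfolding perm by simp
  next
    case 3 then show ?thesis using sorted[OF s23[OF vc]] unfolding perm by simp
  next
    case 4 then show ?thesis using sorted[OF s23[OF s12[OF vc]]] unfolding perm by simp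
  next
    case 5 then show ?thesis using sorted[OF s12[OF s23[OF vc]]] unfolding perm by simp
  next
    case 6 then show ?thesis using sorted[OF s12[OF s23[OF s12[OF vc]]]] unfolding perm by simp
  qed
qed

subsection \<open>Counting vertices of a gentiling\<close>

text \<open>A similarity is a scaled isometry up to translation, hence affine: it maps hulls to
  hulls and multiplies inner products by \<open>\<rho>\<^sup>2\<close>, which preserves
  \<open>angle_at\<close>.\<close>

lemma similar_triangle_vertices:
  assumes D: "det2 (b - a) (c - a) \<noteq> 0" and sim: "similar S (convex hull {a, b, c})"
  shows "\<exists>p q r. S = convex hull {p, q, r} \<and> det2 (q - p) (r - p) \<noteq> 0 \<and>
    angle_at q p r = angle_at b a c \<and> angle_at p q r = angle_at a b c \<and> angle_at p r q = angle_at a c b"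
proof -
  obtain f \<rho> where \<rho>: "0 < \<rho>" and dist: "\<And>x y. dist (f x) (f y) = \<rho> * dist x y"
    and S: "S = f ` (convex hull {a, b, c})"
    using sim unfolding similar_def by blast
  define g where "g x = (1 / \<rho>) *\<^sub>R (f x - f 0)" for x
  have "dist (g x) (g y) = dist x y" for x y
  proof -
    have "g x - g y = (1 / \<rho>) *\<^sub>R (f x - f y)" by (simp add: g_def algebra_simps)
    then show ?thesis using dist[of x y] \<rho> by (simp add: dist_norm)
  qed
  then have orth: "orthogonal_transformation g"
    unfolding orthogonal_transformation_isometry by (simp add: g_def)
  then have lin: "linear g" by (rule orthogonal_transformation_linear)
  have f: "f x = f 0 + \<rho> *\<^sub>R g x" for x using \<rho> by (simp add: g_def)
  have "S = (\<lambda>x. f 0 + \<rho> *\<^sub>R x) ` g ` (convex hull {a, b, c})"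
    unfolding S image_image by (rule image_cong[OF refl f])
  also have "\<dots> = convex hull ((\<lambda>x. f 0 + \<rho> *\<^sub>R x) ` g ` {a, b, c})"
    by (simp only: convex_hull_linear_image[OF lin] convex_hull_affinity)
  also have "\<dots> = convex hull {f a, f b, f c}"
    by (simp add: f[symmetric])
  finally have hull: "S = convex hull {f a, f b, f c}" .
  have diff: "f x - f y = \<rho> *\<^sub>R g (x - y)" for x y
    by (simp add: f[of x] f[of y] linear_diff[OF lin] scaleR_diff_right)
  have inner: "(f x - f y) \<bullet> (f z - f y) = \<rho>\<^sup>2 * ((x - y) \<bullet> (z - y))" for x y z
    unfolding diff using orth by (simp add: orthogonal_transformation_def power2_eq_square)
  have norm: "norm (f x - f y) = \<rho> * norm (x - y)" for x y
    using dist[of x y] by (simp add: dist_norm)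
  have angle: "angle_at (f x) (f y) (f z) = angle_at x y z" for x y z
    unfolding angle_at_def inner norm using \<rho> by (simp add: power2_eq_square)
  \<comment> \<open>Only squares are compared, since a reflection flips the sign; Lagrange's
    identity supplies them.\<close>
  have "(det2 (f b - f a) (f c - f a))\<^sup>2 = (\<rho>\<^sup>2 * det2 (b - a) (c - a))\<^sup>2"
  proof -
    have "((f b - f a) \<bullet> (f c - f a))\<^sup>2 + (det2 (f b - f a) (f c - f a))\<^sup>2
        = (\<rho>\<^sup>2)\<^sup>2 * ((norm (b - a))\<^sup>2 * (norm (c - a))\<^sup>2)"
      unfolding det2_squared norm by (simp add: power_mult_distrib power2_eq_square)
    moreover have "e = (t * d)\<^sup>2" if "(t * x)\<^sup>2 + e = t\<^sup>2 * (x\<^sup>2 + d\<^sup>2)" for t x d e :: real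
      using that by (simp add: power_mult_distrib distrib_left)
    ultimately show ?thesis unfolding inner det2_squared[symmetric] by blast
  qed
  then have "det2 (f b - f a) (f c - f a) \<noteq> 0" using \<rho> D by auto
  then show ?thesis using hull angle by blast
qed

lemma sum_weighted_of_bool:
  fixes P Q R :: "'a \<Rightarrow> bool" and \<alpha> \<beta> \<gamma> \<delta> :: real
  shows "(\<Sum>S\<in>\<T>. of_bool (P S) * \<alpha> + of_bool (Q S) * \<beta> + of_bool (R S) * \<gamma> + real (j S) * \<delta>)
    = real (\<Sum>S\<in>\<T>. of_bool (P S)) * \<alpha> + real (\<Sum>S\<in>\<T>. of_bool (Q S)) * \<beta>
      + real (\<Sum>S\<in>\<T>. of_bool (R S)) * \<gamma> + real (\<Sum>S\<in>\<T>. j S) * \<delta>"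
  by (simp add: sum.distrib sum_distrib_right)

text \<open>\<open>V\<close> collects the corners and all vertices of tiles. At each point the
  angles of the tiles add up to the angle of the big triangle; contributions of tiles that do not
  have the point as a vertex are multiples of \<open>pi\<close> and get separated off.\<close>

lemma gentiling_vertex_count:
  fixes a b c :: "real^2"
  assumes acute: "acute_triangle a b c" and til: "gentiling r (convex hull {a, b, c}) \<T>"
    and w: "w \<in> {a, b, c}" "card {S \<in> \<T>. w \<in> S} = k"
  shows "\<exists>V l m n. vertex_count V k a b c (angle_at b a c) (angle_at a b c) (angle_at a c b) l m n"
proof -
  define \<alpha> \<beta> \<gamma> where "\<alpha> = angle_at b a c" and "\<beta> = angle_at a b c" and "\<gamma> = angle_at a c b"
  define T where "T = convex hull {a, b, c}"
  have D: "det2 (b - a) (c - a) \<noteq> 0"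
    using acute collinear_if_det2_eq_0 unfolding acute_triangle_def by blast
  then have D': "det2 (a - b) (c - b) \<noteq> 0" "det2 (a - c) (b - c) \<noteq> 0"
    by (simp_all add: det2_def algebra_simps)
  have neq: "a \<noteq> b" "a \<noteq> c" "b \<noteq> c" using D D' by (auto simp: det2_def)
  have pos: "0 < \<alpha>" "0 < \<beta>" "0 < \<gamma>"
    unfolding \<alpha>_def \<beta>_def \<gamma>_def using angle_at_bounds(1) D D' by auto
  have small: "\<alpha> < pi / 2" "\<beta> < pi / 2" "\<gamma> < pi / 2"
    using acute by (auto simp: acute_triangle_def triangle_angles_def \<alpha>_def \<beta>_def \<gamma>_def)
  have sum_pi: "\<alpha> + \<beta> + \<gamma> = pi"
    unfolding \<alpha>_def \<beta>_def \<gamma>_def by (rule triangle_angle_sum[OF D])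
  have fin: "finite \<T>" and un: "\<Union>\<T> = T"
    and sim: "\<And>S. S \<in> \<T> \<Longrightarrow> similar S T"
    and disj: "pairwise (\<lambda>S S'. interior S \<inter> interior S' = {}) \<T>"
    using til by (auto simp: gentiling_def T_def)
  have corner: "has_angle (convex hull {x, y, z}) x (angle_at y x z)"
    "has_angle (convex hull {x, y, z}) y (angle_at x y z)"
    "has_angle (convex hull {x, y, z}) z (angle_at x z y)" if d: "det2 (y - x) (z - x) \<noteq> 0" for x y z
  proof -
    have d': "det2 (x - y) (z - y) \<noteq> 0" "det2 (x - z) (y - z) \<noteq> 0"
      using d by (simp_all add: det2_def algebra_simps)
    show "has_angle (convex hull {x, y, z}) x (angle_at y x z)" by (rule has_angle_vertex[OF d])
    show "has_angle (convex hull {x, y, z}) y (angle_at x y z)"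
      using has_angle_vertex[OF d'(1)] by (simp add: insert_commute)
    show "has_angle (convex hull {x, y, z}) z (angle_at x z y)"
      using has_angle_vertex[OF d'(2)] by (simp add: insert_commute)
  qed
  have "\<forall>S\<in>\<T>. \<exists>p q r. S = convex hull {p, q, r} \<and> det2 (q - p) (r - p) \<noteq> 0 \<and>
      angle_at q p r = \<alpha> \<and> angle_at p q r = \<beta> \<and> angle_at p r q = \<gamma>"
    using similar_triangle_vertices[OF D] sim unfolding T_def \<alpha>_def \<beta>_def \<gamma>_def by blast
  \<comment> \<open>One labelling per tile is fixed here, so even with equal angles each tile adds
    exactly one to each of the three totals.\<close>
  then obtain p q r where tile: "\<And>S. S \<in> \<T> \<Longrightarrow> S = convex hull {p S, q S, r S} \<and>
      det2 (q S - p S) (r S - p S) \<noteq> 0 \<and> angle_at (q S) (p S) (r S) = \<alpha> \<and>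
      angle_at (p S) (q S) (r S) = \<beta> \<and> angle_at (p S) (r S) (q S) = \<gamma>"
    by metis
  have distinct: "p S \<noteq> q S" "p S \<noteq> r S" "q S \<noteq> r S" if "S \<in> \<T>" for S
    using tile[OF that] by (auto simp: det2_def)
  have mem: "p S \<in> S" "q S \<in> S" "r S \<in> S" if "S \<in> \<T>" for S
    using tile[OF that] hull_subset[of "{p S, q S, r S}" convex] by auto
  define l where "l v = (\<Sum>S\<in>\<T>. of_bool (p S = v) :: nat)" for v
  define m where "m v = (\<Sum>S\<in>\<T>. of_bool (q S = v) :: nat)" for v
  define n where "n v = (\<Sum>S\<in>\<T>. of_bool (r S = v) :: nat)" for v
  define V where "V = {a, b, c} \<union> p ` \<T> \<union> q ` \<T> \<union> r ` \<T>"
  have finV: "finite V" using fin by (simp add: V_def)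
  have count: "(\<Sum>v\<in>V. \<Sum>S\<in>\<T>. of_bool (h S = v) :: nat) = card \<T>" if "h ` \<T> \<subseteq> V" for h
  proof -
    have "(\<Sum>v\<in>V. of_bool (h S = v) :: nat) = 1" if "S \<in> \<T>" for S
      using finV \<open>h ` \<T> \<subseteq> V\<close> that by (subst sum.cong[OF refl of_bool_def]) auto
    then show ?thesis by (subst sum.swap) simp
  qed
  have totals: "sum l V = card \<T>" "sum m V = card \<T>" "sum n V = card \<T>"
    unfolding l_def m_def n_def by (rule count, force simp: V_def)+
  \<comment> \<open>\<open>j\<close> is 0 at vertices and outside the tile, 1 inside an edge and 2
    in the interior. The last clause makes the three counts exhaust the tiles at \<open>v\<close>
    once no straight angle occurs there.\<close>
  have tile_angle: "\<exists>j :: nat. has_angle S v (of_bool (p S = v) * \<alpha> + of_bool (q S = v) * \<beta>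
      + of_bool (r S = v) * \<gamma> + real j * pi) \<and> (j = 0 \<longrightarrow> v \<in> S \<longrightarrow> v \<in> {p S, q S, r S})"
    if "S \<in> \<T>" for S v
  proof -
    note t = tile[OF that] and d = distinct[OF that] and mS = mem[OF that]
    have t': "has_angle S (p S) \<alpha>" "has_angle S (q S) \<beta>" "has_angle S (r S) \<gamma>"
      using corner[of "q S" "p S" "r S"] t by metis+
    consider "v = p S" | "v = q S" | "v = r S" | "v \<notin> S" | "v \<in> S" "v \<notin> {p S, q S, r S}" by blast
    then show ?thesis
    proof cases
      case 4
      have "closed S" using t by (metis compact_imp_closed finite_imp_compact_convex_hull finite.emptyI finite_insert)
      then show ?thesis using has_angle_outside[of S v] 4 mS by (intro exI[of _ 0]) auto
    next
      case 5
      then have "has_angle S v pi \<or> has_angle S v (2 * pi)"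
        using has_angle_nonvertex[of "q S" "p S" "r S" v] t by metis
      then have "has_angle S v (real 1 * pi) \<or> has_angle S v (real 2 * pi)" by simp
      then obtain j :: nat where "has_angle S v (real j * pi)" "j \<noteq> 0" by (metis one_neq_zero zero_neq_numeral)
      then show ?thesis using 5 by (intro exI[of _ j]) auto
    qed (use t' d in \<open>auto intro!: exI[of _ "0 :: nat"]\<close>)
  qed
  have vertex_sum: "\<exists>J :: nat. has_angle T v (real (l v) * \<alpha> + real (m v) * \<beta> + real (n v) * \<gamma> + real J * pi)
      \<and> (J = 0 \<longrightarrow> l v + m v + n v = card {S \<in> \<T>. v \<in> S})" for v
  proof -
    obtain j :: "(real^2) set \<Rightarrow> nat" where j: "\<And>S. S \<in> \<T> \<Longrightarrow> has_angle S v (of_bool (p S = v) * \<alpha> + of_bool (q S = v) * \<beta>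
      + of_bool (r S = v) * \<gamma> + real (j S) * pi) \<and> (j S = 0 \<longrightarrow> v \<in> S \<longrightarrow> v \<in> {p S, q S, r S})"
      using tile_angle[of _ v] by metis
    have "convex S \<and> closed S" if "S \<in> \<T>" for S
      using tile[OF that]
      by (metis compact_imp_closed convex_convex_hull finite_imp_compact_convex_hull finite.emptyI finite_insert)
    then have "has_angle T v (\<Sum>S\<in>\<T>. of_bool (p S = v) * \<alpha> + of_bool (q S = v) * \<beta>
      + of_bool (r S = v) * \<gamma> + real (j S) * pi)"
      unfolding un[symmetric] using fin disj j by (intro has_angle_Union) auto
    then have "has_angle T v (real (l v) * \<alpha> + real (m v) * \<beta> + real (n v) * \<gamma> + real (sum j \<T>) * pi)"
      unfolding sum_weighted_of_bool l_def m_def n_def .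
    moreover have "l v + m v + n v = card {S \<in> \<T>. v \<in> S}" if "sum j \<T> = 0"
    proof -
      have vx: "v \<in> {p S, q S, r S}" if "S \<in> \<T>" "v \<in> S" for S
        using j[OF that(1)] that \<open>sum j \<T> = 0\<close> fin by simp
      have "l v + m v + n v = (\<Sum>S\<in>\<T>. of_bool (p S = v) + of_bool (q S = v) + of_bool (r S = v))"
        by (simp add: l_def m_def n_def sum.distrib)
      also have "\<dots> = (\<Sum>S\<in>\<T>. of_bool (v \<in> S))"
      proof (rule sum.cong[OF refl])
        fix S assume S: "S \<in> \<T>"
        show "of_bool (p S = v) + of_bool (q S = v) + of_bool (r S = v) = (of_bool (v \<in> S) :: nat)"
          using vx[OF S] distinct[OF S] mem[OF S] by auto
      qed
      also have "\<dots> = card {S \<in> \<T>. v \<in> S}" using fin by (simp add: Int_def)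
      finally show ?thesis .
    qed
    ultimately show ?thesis by (intro exI[of _ "sum j \<T>"] conjI impI)
  qed
  have at_corner: "real (l v) * \<alpha> + real (m v) * \<beta> + real (n v) * \<gamma> = \<theta> \<and> l v + m v + n v = card {S \<in> \<T>. v \<in> S}"
    if "has_angle T v \<theta>" "\<theta> < pi / 2" for v \<theta>
  proof -
    obtain J :: nat where J: "has_angle T v (real (l v) * \<alpha> + real (m v) * \<beta> + real (n v) * \<gamma> + real J * pi)"
      "J = 0 \<longrightarrow> l v + m v + n v = card {S \<in> \<T>. v \<in> S}" using vertex_sum by blast
    have eq: "real (l v) * \<alpha> + real (m v) * \<beta> + real (n v) * \<gamma> + real J * pi = \<theta>"
      using has_angle_unique J(1) that(1) by blast
    \<comment> \<open>A straight angle does not fit into an acute corner.\<close>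
    have "J = 0"
    proof (rule ccontr)
      assume "J \<noteq> 0"
      then have "pi \<le> real J * pi" by simp
      moreover have "0 \<le> real (l v) * \<alpha>" "0 \<le> real (m v) * \<beta>" "0 \<le> real (n v) * \<gamma>" using pos by auto
      ultimately show False using eq that(2) pi_gt_zero by linarith
    qed
    then show ?thesis using J eq by simp
  qed
  have not_corner: "real (l v) * \<alpha> + real (m v) * \<beta> + real (n v) * \<gamma> \<in> {pi, 2 * pi}"
    if v: "v \<in> V - {a, b, c}" for v
  proof -
    obtain S where S: "S \<in> \<T>" "p S = v \<or> q S = v \<or> r S = v" using v by (auto simp: V_def)
    then have "v \<in> T" using mem[OF S(1)] un by auto
    then have T: "has_angle T v pi \<or> has_angle T v (2 * pi)"
      using has_angle_nonvertex[OF D] v unfolding T_def by blast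
    obtain J :: nat where J: "has_angle T v (real (l v) * \<alpha> + real (m v) * \<beta> + real (n v) * \<gamma> + real J * pi)"
      using vertex_sum by blast
    have "0 < l v + m v + n v"
      unfolding l_def m_def n_def sum.distrib[symmetric]
      using S fin by (intro sum_pos2[of _ S]) auto
    then have "0 < real (l v) * \<alpha> \<or> 0 < real (m v) * \<beta> \<or> 0 < real (n v) * \<gamma>"
      using pos by auto
    moreover have "0 \<le> real (l v) * \<alpha>" "0 \<le> real (m v) * \<beta>" "0 \<le> real (n v) * \<gamma>"
      using pos by auto
    ultimately have "0 < real (l v) * \<alpha> + real (m v) * \<beta> + real (n v) * \<gamma>" by linarith
    moreover define s where "s = real (l v) * \<alpha> + real (m v) * \<beta> + real (n v) * \<gamma>"
    ultimately have s: "0 < s" by simp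
    have eq: "s + real J * pi = pi \<or> s + real J * pi = 2 * pi"
      using T J has_angle_unique unfolding s_def by blast
    \<comment> \<open>Some tile has \<open>v\<close> as a vertex, so \<open>s\<close> is positive
      and \<open>J = 2\<close> would overfill the full angle. If \<open>J = 1\<close>, exactly
      \<open>pi\<close> is left for \<open>s\<close>.\<close>
    have "J < 2"
    proof (rule ccontr)
      assume "\<not> J < 2"
      then have "2 * pi \<le> real J * pi" by (intro mult_right_mono) auto
      then show False using eq s pi_gt_zero by linarith
    qed
    then have "J = 0 \<or> J = 1" by auto
    then show ?thesis using eq s unfolding s_def[symmetric] by auto
  qed
  have angles: "has_angle T a \<alpha>" "has_angle T b \<beta>" "has_angle T c \<gamma>"
    using corner[OF D] by (simp_all add: T_def \<alpha>_def \<beta>_def \<gamma>_def)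
  note ca = at_corner[OF angles(1) small(1)] and cb = at_corner[OF angles(2) small(2)]
    and cc = at_corner[OF angles(3) small(3)]
  have "\<exists>v\<in>{a, b, c}. l v + m v + n v = k" using w ca cb cc by auto
  then have "vertex_count V k a b c \<alpha> \<beta> \<gamma> l m n"
    unfolding vertex_count_def using finV totals neq pos small sum_pi ca cb cc not_corner
    by (simp add: V_def)
  then show ?thesis unfolding \<alpha>_def \<beta>_def \<gamma>_def by blast
qed

theorem theorem8:
  fixes a b c :: "real^2"
  assumes "acute_triangle a b c"
  shows "(\<forall>k\<ge>4. \<not> (\<exists>\<T>. splitting_gentiling k a b c \<T>)) \<and>
         ((\<exists>\<T>. splitting_gentiling 3 a b c \<T>) \<longrightarrow>
            triangle_angles a b c = {# 2 / 13 * pi, 5 / 13 * pi, 6 / 13 * pi #} \<or>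
            triangle_angles a b c = {# 2 / 15 * pi, 6 / 15 * pi, 7 / 15 * pi #})"
proof -
  have "k = 3 \<and> (triangle_angles a b c = {# 2 / 13 * pi, 5 / 13 * pi, 6 / 13 * pi #} \<or>
      triangle_angles a b c = {# 2 / 15 * pi, 6 / 15 * pi, 7 / 15 * pi #})"
    if split: "splitting_gentiling k a b c \<T>" and k: "k \<ge> 3" for k \<T>
  proof -
    obtain r w where "gentiling r (convex hull {a, b, c}) \<T>" "w \<in> {a, b, c}" "card {S \<in> \<T>. w \<in> S} = k"
      using split unfolding splitting_gentiling_def by blast
    then obtain V l m n where
      "vertex_count V k a b c (angle_at b a c) (angle_at a b c) (angle_at a c b) l m n"
      using gentiling_vertex_count[OF assms] by blast
    then show ?thesis
      unfolding triangle_angles_def by (rule vertex_count_classification) (fact k)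
  qed
  note split = this
  show ?thesis
  proof (intro conjI allI impI notI)
    fix k :: nat assume "k \<ge> 4" "\<exists>\<T>. splitting_gentiling k a b c \<T>"
    then obtain \<T> where "splitting_gentiling k a b c \<T>" by blast
    then have "k = 3" using split \<open>k \<ge> 4\<close> by fastforce
    then show False using \<open>k \<ge> 4\<close> by simp
  next
    assume "\<exists>\<T>. splitting_gentiling 3 a b c \<T>"
    then show "triangle_angles a b c = {# 2 / 13 * pi, 5 / 13 * pi, 6 / 13 * pi #} \<or>
      triangle_angles a b c = {# 2 / 15 * pi, 6 / 15 * pi, 7 / 15 * pi #}"
      using split[of 3] by auto
  qed
qed

end
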